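(* Let $u$ be an integer with $u\ge2$. (1) There exists a real flat ETF with parameters $(d,n)=(u(2u-1),4u^2)$ if and only if there exists a QSD with parameters $$(v,k,\lambda,r,b,x,y)=\bigl(2u^2-u,\ u^2-u,\ u^2-u-1,\ 2u^2-u-1,\ 4u^2-1,\ \tfrac{u(u-2)}2,\ \tfrac{u(u-1)}2\bigr).$$ Such ETFs exist whenever there exists a Hadamard matrix of size $u$, or alternatively, whenever there exist a Hadamard matrix of size $2u$ and $u-2$ mutually orthogonal Latin squares (MOLS) of size $2u$, such as when $u=6$. (2) Similarly, there exists a real flat ETF with parameters $(d,n)=(u(2u+1),4u^2)$ if and only if there exists a QSD with parameters $$(v,k,\lambda,r,b,x,y)=\bigl(2u^2+u,\ u^2,\ u^2-u,\ 2u^2-u,\ 4u^2-1,\ \tfrac{u(u-1)}2,\ \tfrac{u^2}2\bigr).$$ Such ETFs exist whenever there exists a Hadamard matrix of size $u$, or alternatively, whenever there exist a Hadamard matrix of size $2u$ and $u-1$ MOLS of size $2u$, such as when $u=6$. (3) In either case (i.e. if an ETF as in (1) or as in (2) exists), $u$ is necessarily even. Also, when there exists a Hadamard matrix of size $u$, the ETFs in (1) and (2) can be chosen to be Naimark complements of each other.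
   Context: A sequence of vectors $\{\varphi_j\}_{j=1}^n$ in $\mathbb{R}^d$ with synthesis operator $\mathbf\Phi$ (the $d\times n$ matrix whose $j$th column is $\varphi_j$) is a (real) equiangular tight frame (ETF) for $\mathbb{R}^d$, with parameters $(d,n)$, if there exist $\beta>0$, $\gamma\ge0$, $\alpha>0$ such that $\|\varphi_j\|^2=\beta$ for all $j$, $|\langle\varphi_j,\varphi_{j'}\rangle|=\gamma$ for all $j\ne j'$, and $\mathbf{\Phi}\mathbf{\Phi}^{\mathrm T}=\alpha\mathbf{I}$. It is flat if every entry of $\mathbf\Phi$ is $\pm1$. A Naimark complement of such an ETF (with $n>d$) is the sequence of columns of a real $(n-d)\times n$ matrix $\widetilde{\mathbf{\Phi}}$ such that $\alpha^{-1/2}\begin{bmatrix}\mathbf{\Phi}\\ \widetilde{\mathbf{\Phi}}\end{bmatrix}$ is orthogonal. A Hadamard matrix of size $m$ is an $m\times m$ $\{\pm1\}$-valued matrix $\mathbf H$ with $\mathbf H\mathbf H^{\mathrm T}=m\mathbf I$. Given integers $v>k>0$, $b>0$, $\lambda$, $r$, a $\mathrm{BIBD}(v,k,\lambda,r,b)$ is a set of $v$ vertices together with $b$ subsets of it (blocks) such that each block contains exactly $k$ vertices, each vertex is in exactly $r$ blocks, and every pair of distinct vertices is in exactly $\lambda$ blocks. A QSD with parameters $(v,k,\lambda,r,b,x,y)$ (quasi-symmetric design with block intersection numbers $y>x\ge0$) is a $\mathrm{BIBD}(v,k,\lambda,r,b)$ with $b>v$ such that the cardinality of the intersection of any two distinct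 blocks (i.e. blocks with distinct indices) is either $x$ or $y$. *)

theory Defs
  imports Complex_Main "Jordan_Normal_Form.Matrix"
begin

text \<open>
  A sequence of $n$ vectors in $d$-space is represented by its synthesis operator: the
  $d \times n$ matrix whose columns are the vectors.
\<close>

definition equiangular_tight_frame :: "nat \<Rightarrow> nat \<Rightarrow> real mat \<Rightarrow> bool" where
  "equiangular_tight_frame d n \<Phi> \<longleftrightarrow>
     \<Phi> \<in> carrier_mat d n \<and>
     (\<exists>\<beta>>0. \<forall>j<n. col \<Phi> j \<bullet> col \<Phi> j = \<beta>) \<and>
     (\<exists>\<gamma>\<ge>0. \<forall>j<n. \<forall>j'<n. j \<noteq> j' \<longrightarrow> \<bar>col \<Phi> j \<bullet> col \<Phi> j'\<bar> = \<gamma>) \<and>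
     (\<exists>\<alpha>>0. \<Phi> * transpose_mat \<Phi> = \<alpha> \<cdot>\<^sub>m 1\<^sub>m d)"

definition pm1_mat :: "real mat \<Rightarrow> bool" where
  "pm1_mat A \<longleftrightarrow> (\<forall>i<dim_row A. \<forall>j<dim_col A. A $$ (i, j) \<in> {1, -1})"

definition flat_etf :: "nat \<Rightarrow> nat \<Rightarrow> real mat \<Rightarrow> bool" where
  "flat_etf d n \<Phi> \<longleftrightarrow> equiangular_tight_frame d n \<Phi> \<and> pm1_mat \<Phi>"

text \<open>
  The library's \<^const>\<open>orthogonal_mat\<close> only asks for pairwise orthogonal nonzero columns, with no
  normalization and no squareness, so it is not the notion needed here.
\<close>

definition real_orthogonal_mat :: "real mat \<Rightarrow> bool" where
  "real_orthogonal_mat A \<longleftrightarrow>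
     square_mat A \<and> inverts_mat A (transpose_mat A) \<and> inverts_mat (transpose_mat A) A"

text \<open>For $d > 0$ the tight frame constant \<open>\<alpha>\<close> below is determined by \<open>\<Phi>\<close>.\<close>

definition naimark_complement :: "nat \<Rightarrow> nat \<Rightarrow> real mat \<Rightarrow> real mat \<Rightarrow> bool" where
  "naimark_complement d n \<Phi> \<Psi> \<longleftrightarrow>
     d < n \<and> equiangular_tight_frame d n \<Phi> \<and> \<Psi> \<in> carrier_mat (n - d) n \<and>
     (\<exists>\<alpha>>0. \<Phi> * transpose_mat \<Phi> = \<alpha> \<cdot>\<^sub>m 1\<^sub>m d \<and>
        real_orthogonal_mat ((1 / sqrt \<alpha>) \<cdot>\<^sub>m (\<Phi> @\<^sub>r \<Psi>)))"

definition hadamard_matrix :: "nat \<Rightarrow> real mat \<Rightarrow> bool" where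
  "hadamard_matrix m H \<longleftrightarrow>
     H \<in> carrier_mat m m \<and> pm1_mat H \<and> H * transpose_mat H = real m \<cdot>\<^sub>m 1\<^sub>m m"

text \<open>
  Blocks are given as an indexed family \<open>B 0, \<dots>, B (b - 1)\<close>, so that repeated blocks are not
  excluded by the representation.
\<close>

definition bibd :: "'a set \<Rightarrow> (nat \<Rightarrow> 'a set) \<Rightarrow> nat \<Rightarrow> nat \<Rightarrow> nat \<Rightarrow> nat \<Rightarrow> nat \<Rightarrow> bool" where
  "bibd V B v k l r b \<longleftrightarrow>
     v > k \<and> k > 0 \<and> b > 0 \<and>
     finite V \<and> card V = v \<and>
     (\<forall>i<b. B i \<subseteq> V \<and> card (B i) = k) \<and>
     (\<forall>p\<in>V. card {i. i < b \<and> p \<in> B i} = r) \<and>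
     (\<forall>p\<in>V. \<forall>q\<in>V. p \<noteq> q \<longrightarrow> card {i. i < b \<and> p \<in> B i \<and> q \<in> B i} = l)"

definition quasi_symmetric_design ::
  "'a set \<Rightarrow> (nat \<Rightarrow> 'a set) \<Rightarrow> nat \<Rightarrow> nat \<Rightarrow> nat \<Rightarrow> nat \<Rightarrow> nat \<Rightarrow> nat \<Rightarrow> nat \<Rightarrow> bool" where
  "quasi_symmetric_design V B v k l r b x y \<longleftrightarrow>
     bibd V B v k l r b \<and> b > v \<and> y > x \<and>
     (\<forall>i<b. \<forall>j<b. i \<noteq> j \<longrightarrow> card (B i \<inter> B j) \<in> {x, y})"

definition qsd_exists :: "nat \<Rightarrow> nat \<Rightarrow> nat \<Rightarrow> nat \<Rightarrow> nat \<Rightarrow> nat \<Rightarrow> nat \<Rightarrow> bool" where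
  "qsd_exists v k l r b x y \<longleftrightarrow>
     (\<exists>(V :: nat set) B. quasi_symmetric_design V B v k l r b x y)"

definition latin_square :: "nat \<Rightarrow> (nat \<Rightarrow> nat \<Rightarrow> nat) \<Rightarrow> bool" where
  "latin_square m L \<longleftrightarrow>
     (\<forall>i<m. bij_betw (\<lambda>j. L i j) {..<m} {..<m}) \<and>
     (\<forall>j<m. bij_betw (\<lambda>i. L i j) {..<m} {..<m})"

definition orthogonal_latin_squares ::
  "nat \<Rightarrow> (nat \<Rightarrow> nat \<Rightarrow> nat) \<Rightarrow> (nat \<Rightarrow> nat \<Rightarrow> nat) \<Rightarrow> bool" where
  "orthogonal_latin_squares m L M \<longleftrightarrow>
     bij_betw (\<lambda>(i, j). (L i j, M i j)) ({..<m} \<times> {..<m}) ({..<m} \<times> {..<m})"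

definition mols :: "nat \<Rightarrow> nat \<Rightarrow> (nat \<Rightarrow> nat \<Rightarrow> nat \<Rightarrow> nat) \<Rightarrow> bool" where
  "mols t m L \<longleftrightarrow>
     (\<forall>s<t. latin_square m (L s)) \<and>
     (\<forall>s<t. \<forall>s'<t. s \<noteq> s' \<longrightarrow> orthogonal_latin_squares m (L s) (L s'))"

end

theory Submission
  imports Defs "Jordan_Normal_Form.Determinant"
begin

text \<open>
  A flat equiangular tight frame (ETF) with $4u^2$ vectors in dimension $d = 2u^2 \pm u$ has inner
  products \<open>\<plusminus>u\<close>. Switching signs of rows and columns so that the first vector is constant and
  all other vectors have entry sum \<open>-u\<close>, the remaining $4u^2 - 1$ vectors are the $\pm1$ incidence
  vectors of a quasi-symmetric design: orthogonality of rows determines \<open>r\<close> and \<open>\<lambda>\<close>, and the two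
  values of an inner product are the two intersection numbers. For odd \<open>u\<close> integrality leaves only
  one of the two signs for all pairs, which contradicts tightness.

  From $t$ mutually orthogonal Latin squares one gets a net of $t + 2$ parallel classes on a
  $2u \times 2u$ grid; each class carries the nonconstant rows of a Hadamard matrix of size $2u$.
  Two points lie on at most one common line, so the Gram matrix has only two off-diagonal values.
  From a Hadamard matrix $H$ of size $u$ one uses instead the pairs of a \<open>2u\<close>-set, resolved into
  the $2u - 1$ rounds of a round-robin tournament: on $\{p\} \times \{j\}$ the row \<open>(c, i)\<close> takes the
  value \<open>H i (pair of p in round c) * K c j\<close> with a Hadamard matrix $K$ of size $2u$. Functions
  antisymmetric on the pairs of a round, together with the functions depending on \<open>p\<close> only, have
  flat orthogonal bases as well, and these give the Naimark complement.
\<close>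

subsection \<open>Frames from orthogonal rows\<close>

lemma pm1_square: "a \<in> {1, -1 :: real} \<Longrightarrow> a * a = 1"
  by auto

lemma pm1_mult: "a \<in> {1, -1 :: real} \<Longrightarrow> b \<in> {1, -1} \<Longrightarrow> a * b \<in> {1, -1}"
  by auto

text \<open>Orthogonality is proved below for sums over convenient index sets such as pairs or
  tagged unions; the enumerations \<open>f\<close> and \<open>g\<close> transport it to
  matrices.\<close>

lemma mat_times_transpose_eq_smult_one:
  fixes F :: "'i \<Rightarrow> 'j \<Rightarrow> real"
  assumes f: "bij_betw f {..<d} I" and g: "bij_betw g {..<n} J"
    and rows: "\<And>i i'. i \<in> I \<Longrightarrow> i' \<in> I \<Longrightarrow> (\<Sum>j\<in>J. F i j * F i' j) = (if i = i' then c else 0)"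
  shows "mat d n (\<lambda>(a, b). F (f a) (g b)) * transpose_mat (mat d n (\<lambda>(a, b). F (f a) (g b)))
    = c \<cdot>\<^sub>m 1\<^sub>m d"
proof (rule eq_matI, goal_cases)
  case (1 a a')
  then have a: "a < d" "a' < d" by auto
  then have fa: "f a \<in> I" "f a' \<in> I" "f a = f a' \<longleftrightarrow> a = a'"
    using f by (auto simp: bij_betw_def inj_on_def)
  have "(\<Sum>b<n. F (f a) (g b) * F (f a') (g b)) = (\<Sum>j\<in>J. F (f a) j * F (f a') j)"
    by (rule sum.reindex_bij_betw[OF g])
  then show ?case
    using a fa rows[OF fa(1,2)] by (simp add: scalar_prod_def lessThan_atLeast0)
qed auto

text \<open>Orthogonal rows make \<open>(1 / c) \<cdot>\<^sub>m transpose_mat A\<close> a right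
  inverse of a square matrix \<open>A\<close>; it is then also a left inverse, which is
  orthogonality of the columns.\<close>

lemma dual_orthogonality:
  fixes F :: "'i \<Rightarrow> 'j \<Rightarrow> real"
  assumes fin: "finite I" "finite J" and card: "card I = card J" and c: "c \<noteq> 0"
    and rows: "\<And>i i'. i \<in> I \<Longrightarrow> i' \<in> I \<Longrightarrow> (\<Sum>j\<in>J. F i j * F i' j) = (if i = i' then c else 0)"
    and j: "j \<in> J" "j' \<in> J"
  shows "(\<Sum>i\<in>I. F i j * F i j') = (if j = j' then c else 0)"
proof -
  define n where "n = card J"
  obtain f where f: "bij_betw f {..<n} I"
    using ex_bij_betw_nat_finite[OF fin(1)] card by (auto simp: n_def lessThan_atLeast0)
  obtain g where g: "bij_betw g {..<n} J"
    using ex_bij_betw_nat_finite[OF fin(2)] by (auto simp: n_def lessThan_atLeast0)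
  define A where "A = mat n n (\<lambda>(a, b). F (f a) (g b))"
  have A: "A \<in> carrier_mat n n" by (simp add: A_def)
  have "A * ((1 / c) \<cdot>\<^sub>m transpose_mat A) = (1 / c) \<cdot>\<^sub>m (A * transpose_mat A)"
    using A by (simp add: mult_smult_distrib[of _ n n _ n])
  also have "\<dots> = 1\<^sub>m n"
    using c mat_times_transpose_eq_smult_one[OF f g rows]
    unfolding A_def by (intro eq_matI) auto
  finally have "((1 / c) \<cdot>\<^sub>m transpose_mat A) * A = 1\<^sub>m n"
    using mat_mult_left_right_inverse[OF A, of "(1 / c) \<cdot>\<^sub>m transpose_mat A"] A by auto
  then have one: "(1 / c) \<cdot>\<^sub>m (transpose_mat A * A) = 1\<^sub>m n"
    using A by (simp add: mult_smult_assoc_mat[of _ n n _ n])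
  obtain b b' where b: "b < n" "b' < n" "g b = j" "g b' = j'"
    using g j by (auto simp: bij_betw_def)
  have "(1 / c) * (\<Sum>a<n. F (f a) j * F (f a) j') = ((1 / c) \<cdot>\<^sub>m (transpose_mat A * A)) $$ (b, b')"
    using b by (simp add: A_def scalar_prod_def lessThan_atLeast0)
  also have "\<dots> = (if j = j' then 1 else 0)"
    unfolding one using b g by (auto simp: bij_betw_def inj_on_def)
  finally show ?thesis
    using c sum.reindex_bij_betw[OF f, of "\<lambda>i. F i j * F i j'"] by (auto split: if_splits)
qed

text \<open>Entries +-1 force every column to have squared norm \<open>d\<close>, so only distinct
  columns need to be compared; the tight frame constant is \<open>n\<close>.\<close>

lemma flat_etfI:
  fixes F :: "'i \<Rightarrow> 'j \<Rightarrow> real"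
  assumes f: "bij_betw f {..<d} I" and g: "bij_betw g {..<n} J"
    and pm: "\<And>i j. i \<in> I \<Longrightarrow> j \<in> J \<Longrightarrow> F i j \<in> {1, -1}"
    and rows: "\<And>i i'. i \<in> I \<Longrightarrow> i' \<in> I \<Longrightarrow>
      (\<Sum>j\<in>J. F i j * F i' j) = (if i = i' then real n else 0)"
    and cols: "\<And>j j'. j \<in> J \<Longrightarrow> j' \<in> J \<Longrightarrow> j \<noteq> j' \<Longrightarrow> \<bar>\<Sum>i\<in>I. F i j * F i j'\<bar> = \<gamma>"
    and pos: "0 < d" "0 < n" "0 \<le> \<gamma>"
  shows "flat_etf d n (mat d n (\<lambda>(a, b). F (f a) (g b)))" (is "flat_etf d n ?A")
proof -
  have fI: "f a \<in> I" if "a < d" for a using f that by (auto simp: bij_betw_def)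
  have gJ: "g b \<in> J" if "b < n" for b using g that by (auto simp: bij_betw_def)
  have g_eq: "g b = g b' \<longleftrightarrow> b = b'" if "b < n" "b' < n" for b b'
    using g that by (auto simp: bij_betw_def inj_on_def)
  have ip: "col ?A b \<bullet> col ?A b' = (\<Sum>i\<in>I. F i (g b) * F i (g b'))" if "b < n" "b' < n" for b b'
    using that sum.reindex_bij_betw[OF f, of "\<lambda>i. F i (g b) * F i (g b')"]
    by (simp add: scalar_prod_def lessThan_atLeast0)
  have card: "card I = d" using bij_betw_same_card[OF f] by simp
  have "col ?A b \<bullet> col ?A b = real d" if "b < n" for b
  proof -
    have "(\<Sum>i\<in>I. F i (g b) * F i (g b)) = (\<Sum>i\<in>I. 1)"
      by (intro sum.cong refl pm1_square pm gJ that)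
    then show ?thesis unfolding ip[OF that that] by (simp add: card)
  qed
  moreover have "\<bar>col ?A b \<bullet> col ?A b'\<bar> = \<gamma>" if "b < n" "b' < n" "b \<noteq> b'" for b b'
    unfolding ip[OF that(1,2)] using that by (intro cols gJ) (auto simp: g_eq)
  moreover have "?A * transpose_mat ?A = real n \<cdot>\<^sub>m 1\<^sub>m d"
    by (rule mat_times_transpose_eq_smult_one[OF f g rows])
  moreover have "pm1_mat ?A"
    unfolding pm1_mat_def using pm fI gJ by auto
  ultimately show ?thesis
    unfolding flat_etf_def equiangular_tight_frame_def using pos
    by (metis mat_carrier of_nat_0_less_iff)
qed

text \<open>Two orthogonal row families with \<open>n\<close> rows in total stack to a square
  matrix; dividing by \<open>sqrt n\<close>, the root of the frame constant, makes it
  orthogonal.\<close>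

lemma naimark_complementI:
  fixes F :: "'i \<Rightarrow> 'j \<Rightarrow> real"
  assumes f: "bij_betw f {..<d} I" and f': "bij_betw f' {..<n - d} I'" and g: "bij_betw g {..<n} J"
    and disj: "I \<inter> I' = {}" and less: "d < n"
    and rows: "\<And>i i'. i \<in> I \<union> I' \<Longrightarrow> i' \<in> I \<union> I' \<Longrightarrow>
      (\<Sum>j\<in>J. F i j * F i' j) = (if i = i' then real n else 0)"
    and etf: "equiangular_tight_frame d n (mat d n (\<lambda>(a, b). F (f a) (g b)))"
  shows "naimark_complement d n (mat d n (\<lambda>(a, b). F (f a) (g b)))
    (mat (n - d) n (\<lambda>(a, b). F (f' a) (g b)))" (is "naimark_complement d n ?A ?B")
proof -
  \<comment> \<open>\<open>h\<close> lists the rows of the frame first and those of the complement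
    from position \<open>d\<close> on, in the order of \<open>@\<^sub>r\<close>.\<close>
  define h where "h a = (if a < d then f a else f' (a - d))" for a
  have "bij_betw h ({..<d} \<union> {d..<n}) (I \<union> I')"
  proof (rule bij_betw_combine)
    show "bij_betw h {..<d} I"
      using f by (rule iffD1[OF bij_betw_cong, rotated]) (simp add: h_def)
    have "bij_betw (\<lambda>a. a - d) {d..<n} {..<n - d}"
      by (rule bij_betw_byWitness[where f' = "\<lambda>a. a + d"]) (auto simp: less)
    then have "bij_betw (f' \<circ> (\<lambda>a. a - d)) {d..<n} I'"
      using f' by (rule bij_betw_trans)
    then show "bij_betw h {d..<n} I'"
      by (rule iffD1[OF bij_betw_cong, rotated]) (simp add: h_def)
  qed (rule disj)
  moreover have "{..<d} \<union> {d..<n} = {..<n}" using less by auto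
  ultimately have h: "bij_betw h {..<n} (I \<union> I')" by simp
  define M where "M = mat n n (\<lambda>(a, b). F (h a) (g b))"
  have M: "M \<in> carrier_mat n n" by (simp add: M_def)
  have append: "?A @\<^sub>r ?B = M"
    unfolding append_rows_def M_def h_def using less by (intro eq_matI) auto
  have MMT: "M * transpose_mat M = real n \<cdot>\<^sub>m 1\<^sub>m n"
    unfolding M_def by (rule mat_times_transpose_eq_smult_one[OF h g rows])
  define N where "N = (1 / sqrt (real n)) \<cdot>\<^sub>m M"
  have N: "N \<in> carrier_mat n n" using M by (simp add: N_def)
  have "N * transpose_mat N = (1 / real n) \<cdot>\<^sub>m (M * transpose_mat M)"
  proof (rule eq_matI, goal_cases)
    case (1 i j)
    then show ?case
      using M by (simp add: N_def scalar_prod_def sum_distrib_left field_simps)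
  qed (use M in \<open>auto simp: N_def\<close>)
  also have "\<dots> = 1\<^sub>m n"
    unfolding MMT using less by (intro eq_matI) auto
  finally have NNT: "N * transpose_mat N = 1\<^sub>m n" .
  then have "transpose_mat N * N = 1\<^sub>m n"
    using mat_mult_left_right_inverse[OF N, of "transpose_mat N"] N by simp
  with NNT have "real_orthogonal_mat N"
    unfolding real_orthogonal_mat_def inverts_mat_def square_mat.simps using N by simp
  moreover have "?A * transpose_mat ?A = real n \<cdot>\<^sub>m 1\<^sub>m d"
    by (rule mat_times_transpose_eq_smult_one[OF f g rows]) auto
  ultimately show ?thesis
    unfolding naimark_complement_def append using etf less N_def
    by (auto intro!: exI[of _ "real n"])
qed

text \<open>Checking columns over \<open>I\<close> suffices: the full square array has orthogonal
  columns, so the partial inner products over \<open>I\<close> and over \<open>I'\<close> are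
  opposite and share the absolute value \<open>\<gamma>\<close>.\<close>

lemma flat_etf_naimark_pair:
  fixes F :: "'i \<Rightarrow> 'j \<Rightarrow> real"
  assumes fin: "finite I" "finite I'" "finite J" and disj: "I \<inter> I' = {}"
    and card: "card I = d" "card I' = d'" "card J = n" "d + d' = n"
    and pos: "0 < d" "0 < d'" "0 \<le> \<gamma>"
    and pm: "\<And>i j. i \<in> I \<union> I' \<Longrightarrow> j \<in> J \<Longrightarrow> F i j \<in> {1, -1}"
    and rows: "\<And>i i'. i \<in> I \<union> I' \<Longrightarrow> i' \<in> I \<union> I' \<Longrightarrow>
      (\<Sum>j\<in>J. F i j * F i' j) = (if i = i' then real n else 0)"
    and cols: "\<And>j j'. j \<in> J \<Longrightarrow> j' \<in> J \<Longrightarrow> j \<noteq> j' \<Longrightarrow> \<bar>\<Sum>i\<in>I. F i j * F i j'\<bar> = \<gamma>"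
  shows "\<exists>\<Phi> \<Psi>. flat_etf d n \<Phi> \<and> flat_etf d' n \<Psi> \<and>
    naimark_complement d n \<Phi> \<Psi> \<and> naimark_complement d' n \<Psi> \<Phi>"
proof -
  obtain f where f: "bij_betw f {..<d} I"
    using ex_bij_betw_nat_finite[OF fin(1)] card by (auto simp: lessThan_atLeast0)
  obtain f' where f': "bij_betw f' {..<d'} I'"
    using ex_bij_betw_nat_finite[OF fin(2)] card by (auto simp: lessThan_atLeast0)
  obtain g where g: "bij_betw g {..<n} J"
    using ex_bij_betw_nat_finite[OF fin(3)] card by (auto simp: lessThan_atLeast0)
  have cols': "\<bar>\<Sum>i\<in>I'. F i j * F i j'\<bar> = \<gamma>" if j: "j \<in> J" "j' \<in> J" "j \<noteq> j'" for j j'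
  proof -
    have "card (I \<union> I') = card J"
      using fin disj card by (simp add: card_Un_disjoint)
    then have "(\<Sum>i\<in>I \<union> I'. F i j * F i j') = 0"
      using dual_orthogonality[of "I \<union> I'" J "real n" F j j'] fin pos rows j card by auto
    then have "(\<Sum>i\<in>I'. F i j * F i j') = - (\<Sum>i\<in>I. F i j * F i j')"
      using fin disj by (simp add: sum.union_disjoint)
    then show ?thesis using cols[OF j] by simp
  qed
  have n: "0 < n" "d < n" "d' < n" "n - d = d'" "n - d' = d" using card pos by auto
  let ?A = "mat d n (\<lambda>(a, b). F (f a) (g b))" and ?B = "mat d' n (\<lambda>(a, b). F (f' a) (g b))"
  have A: "flat_etf d n ?A"
    by (rule flat_etfI[OF f g pm rows cols pos(1) n(1) pos(3)]) auto
  have B: "flat_etf d' n ?B"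
    by (rule flat_etfI[OF f' g pm rows cols' pos(2) n(1) pos(3)]) auto
  have "naimark_complement d n ?A ?B"
    using naimark_complementI[OF f _ g disj n(2) rows, of f'] f' A n(4)
    by (simp add: flat_etf_def)
  moreover have "naimark_complement d' n ?B ?A"
    using naimark_complementI[OF f' _ g _ n(3) rows, of f] f B n(5) disj
    by (simp add: flat_etf_def Un_commute Int_commute)
  ultimately show ?thesis using A B by blast
qed

lemma flat_etf_exI:
  fixes F :: "'i \<Rightarrow> 'j \<Rightarrow> real"
  assumes fin: "finite I" "finite J" and card: "card I = d" "card J = n"
    and pm: "\<And>i j. i \<in> I \<Longrightarrow> j \<in> J \<Longrightarrow> F i j \<in> {1, -1}"
    and rows: "\<And>i i'. i \<in> I \<Longrightarrow> i' \<in> I \<Longrightarrow>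
      (\<Sum>j\<in>J. F i j * F i' j) = (if i = i' then real n else 0)"
    and cols: "\<And>j j'. j \<in> J \<Longrightarrow> j' \<in> J \<Longrightarrow> j \<noteq> j' \<Longrightarrow> \<bar>\<Sum>i\<in>I. F i j * F i j'\<bar> = \<gamma>"
    and pos: "0 < d" "0 < n" "0 \<le> \<gamma>"
  shows "\<exists>\<Phi>. flat_etf d n \<Phi>"
proof -
  obtain f where f: "bij_betw f {..<d} I"
    using ex_bij_betw_nat_finite[OF fin(1)] card by (auto simp: lessThan_atLeast0)
  obtain g where g: "bij_betw g {..<n} J"
    using ex_bij_betw_nat_finite[OF fin(2)] card by (auto simp: lessThan_atLeast0)
  from flat_etfI[OF f g pm rows cols pos] show ?thesis by blast
qed

subsection \<open>Quasi-symmetric designs\<close>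

definition pm_sign :: "bool \<Rightarrow> real" where
  "pm_sign P = (if P then 1 else -1)"

lemma pm_sign_cases: "pm_sign P \<in> {1, -1}"
  by (simp add: pm_sign_def)

lemma pm_sign_eq_1: "a \<in> {1, -1 :: real} \<Longrightarrow> pm_sign (a = 1) = a"
  by (auto simp: pm_sign_def)

lemma pm_sign_eq_of_bool: "pm_sign P = 2 * of_bool P - 1"
  by (simp add: pm_sign_def)

lemma sum_pm_sign:
  assumes "finite A"
  shows "(\<Sum>x\<in>A. pm_sign (P x)) = 2 * real (card {x \<in> A. P x}) - real (card A)"
proof -
  have "A \<inter> {x. P x} = {x \<in> A. P x}" by auto
  then show ?thesis
    using assms by (simp add: pm_sign_eq_of_bool sum_subtractf flip: sum_distrib_left)
qed

text \<open>Linearizing the product of two signs turns an inner product of incidence vectors into an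
  intersection size and two plain sizes.\<close>

lemma sum_pm_sign_mult:
  assumes "finite A"
  shows "(\<Sum>x\<in>A. pm_sign (P x) * pm_sign (Q x)) =
    4 * real (card {x \<in> A. P x \<and> Q x}) - 2 * real (card {x \<in> A. P x})
      - 2 * real (card {x \<in> A. Q x}) + real (card A)"
proof -
  have "pm_sign (P x) * pm_sign (Q x) = 2 * pm_sign (P x \<and> Q x) - pm_sign (P x) - pm_sign (Q x) + 1" for x
    by (simp add: pm_sign_def)
  then show ?thesis
    using assms by (simp add: sum.distrib sum_subtractf sum_pm_sign flip: sum_distrib_left)
qed

text \<open>With a row available (\<open>0 < d\<close>) and entries +-1, the diagonal of the frame
  identity shows that the unspecified constant \<open>\<alpha>\<close> must be
  \<open>n\<close>.\<close>

lemma flat_etfE: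
  assumes "flat_etf d n \<Phi>" "0 < d"
  obtains F \<gamma> where
    "\<And>i j. i < d \<Longrightarrow> j < n \<Longrightarrow> F i j \<in> {1, -1 :: real}"
    "\<And>i i'. i < d \<Longrightarrow> i' < d \<Longrightarrow> (\<Sum>j<n. F i j * F i' j) = (if i = i' then real n else 0)"
    "\<And>j j'. j < n \<Longrightarrow> j' < n \<Longrightarrow> j \<noteq> j' \<Longrightarrow> \<bar>\<Sum>i<d. F i j * F i j'\<bar> = \<gamma>"
    "0 \<le> \<gamma>"
proof -
  define F where "F i j = \<Phi> $$ (i, j)" for i j
  from assms obtain \<alpha> \<gamma> where \<Phi>: "\<Phi> \<in> carrier_mat d n" "pm1_mat \<Phi>"
    and \<gamma>: "0 \<le> \<gamma>" "\<And>j j'. j < n \<Longrightarrow> j' < n \<Longrightarrow> j \<noteq> j' \<Longrightarrow> \<bar>col \<Phi> j \<bullet> col \<Phi> j'\<bar> = \<gamma>"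
    and \<alpha>: "\<Phi> * transpose_mat \<Phi> = \<alpha> \<cdot>\<^sub>m 1\<^sub>m d"
    unfolding flat_etf_def equiangular_tight_frame_def by metis
  have pm: "F i j \<in> {1, -1}" if "i < d" "j < n" for i j
    using that \<Phi> by (auto simp: pm1_mat_def F_def)
  have rows: "(\<Sum>j<n. F i j * F i' j) = (if i = i' then \<alpha> else 0)" if "i < d" "i' < d" for i i'
    using arg_cong[OF \<alpha>, of "\<lambda>A. A $$ (i, i')"] that \<Phi>(1)
    by (simp add: F_def scalar_prod_def lessThan_atLeast0)
  have "(\<Sum>j<n. F 0 j * F 0 j) = (\<Sum>j<n. 1)"
    by (intro sum.cong refl pm1_square pm) (use assms in auto)
  then have "\<alpha> = real n" using rows[of 0 0] assms by simp
  moreover have "\<bar>\<Sum>i<d. F i j * F i j'\<bar> = \<gamma>" if "j < n" "j' < n" "j \<noteq> j'" for j j'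
    using \<gamma>(2)[OF that] that \<Phi>(1) by (simp add: F_def scalar_prod_def lessThan_atLeast0)
  ultimately show thesis
    by (intro that[of F \<gamma>] pm \<gamma>(1)) (simp_all add: rows)
qed

lemma sum_shift_1: "0 < n \<Longrightarrow> (\<Sum>j<n. g j) = g 0 + (\<Sum>j<n - 1. g (Suc j) :: real)"
  using sum.lessThan_Suc_shift[of g "n - 1"] by simp

text \<open>
  Switching signs of rows and columns makes the first column constant and turns its inner
  products with the other columns into \<open>- u\<close>; these become the column sums. Tightness,
  applied to the first column, then fixes the row sums.
\<close>

lemma flat_etf_normalized:
  fixes u d n :: nat and e :: real
  assumes etf: "flat_etf d n \<Phi>" and u: "0 < u" and n: "n = 4 * u\<^sup>2"
    and d: "real d = 2 * real u ^ 2 + e * real u" and e: "e \<in> {1, -1}"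
  obtains f where
    "\<And>i j. i < d \<Longrightarrow> j < n \<Longrightarrow> f i j \<in> {1, -1 :: real}"
    "\<And>i. i < d \<Longrightarrow> f i 0 = 1"
    "\<And>i i'. i < d \<Longrightarrow> i' < d \<Longrightarrow> (\<Sum>j<n. f i j * f i' j) = (if i = i' then real n else 0)"
    "\<And>j j'. j < n \<Longrightarrow> j' < n \<Longrightarrow> j \<noteq> j' \<Longrightarrow> \<bar>\<Sum>i<d. f i j * f i j'\<bar> = real u"
    "\<And>j. 0 < j \<Longrightarrow> j < n \<Longrightarrow> (\<Sum>i<d. f i j) = - real u"
    "\<And>i. i < d \<Longrightarrow> (\<Sum>j<n - 1. f i (Suc j)) = e - 2 * real u"
proof -
  have ee: "e * e = 1" using e by (rule pm1_square)
  have "0 < 2 * real u ^ 2 + e * real u"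
  proof -
    have "1 * real u \<le> real u * real u"
      by (rule mult_right_mono) (use u in auto)
    moreover have "(- 1) * real u \<le> e * real u"
      by (rule mult_right_mono) (use e in auto)
    moreover have "0 < real u" using u by simp
    ultimately show ?thesis unfolding power2_eq_square by linarith
  qed
  with d have dpos: "0 < d" by linarith
  have npos: "0 < n" using n u by simp
  have realn: "real n = 4 * real u ^ 2" using n by simp
  obtain F \<gamma> where
    pm: "\<And>i j. i < d \<Longrightarrow> j < n \<Longrightarrow> F i j \<in> {1, -1 :: real}" and
    rows: "\<And>i i'. i < d \<Longrightarrow> i' < d \<Longrightarrow>
      (\<Sum>j<n. F i j * F i' j) = (if i = i' then real n else 0)" and
    cols: "\<And>j j'. j < n \<Longrightarrow> j' < n \<Longrightarrow> j \<noteq> j' \<Longrightarrow> \<bar>\<Sum>i<d. F i j * F i j'\<bar> = \<gamma>" and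
    \<gamma>: "0 \<le> \<gamma>"
    by (rule flat_etfE[OF etf dpos]) (rule that)
  have sq: "F i j * F i j = 1" if "i < d" "j < n" for i j
    using pm[OF that] by (rule pm1_square)
  \<comment> \<open>\<open>G\<close> is row 0 of the Gram matrix. Its squared length is
    \<open>d * n\<close> by tightness and \<open>d * d + (n - 1) * \<gamma>\<^sup>2\<close> by
    equiangularity; comparing the two yields \<open>\<gamma> = u\<close>.\<close>
  define G where "G j = (\<Sum>i<d. F i 0 * F i j)" for j
  have G0: "G 0 = real d" using sq npos by (simp add: G_def)
  have "(\<Sum>j<n. G j * G j) = (\<Sum>j<n. \<Sum>i<d. \<Sum>i'<d. F i 0 * F i' 0 * (F i j * F i' j))"
    unfolding G_def sum_product by (intro sum.cong refl) (simp add: mult_ac)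
  also have "\<dots> = (\<Sum>i<d. \<Sum>i'<d. \<Sum>j<n. F i 0 * F i' 0 * (F i j * F i' j))"
    by (subst sum.swap) (intro sum.cong refl sum.swap)
  also have "\<dots> = (\<Sum>i<d. \<Sum>i'<d. F i 0 * F i' 0 * (if i = i' then real n else 0))"
    by (intro sum.cong refl) (simp add: rows flip: sum_distrib_left)
  also have "\<dots> = (\<Sum>i<d. real n)"
    by (intro sum.cong refl) (use sq npos in \<open>simp add: if_distrib cong: if_cong\<close>)
  finally have "(\<Sum>j<n. G j * G j) = real d * real n" by simp
  moreover have "(\<Sum>j<n. G j * G j) = real d * real d + (\<Sum>j<n - 1. \<gamma>\<^sup>2)"
  proof -
    have "G (Suc j) * G (Suc j) = \<gamma>\<^sup>2" if "j < n - 1" for j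
      using cols[of 0 "Suc j"] that npos
      by (metis G_def Suc_less_eq Suc_pred' old.nat.distinct(1) power2_abs power2_eq_square)
    then show ?thesis
      using npos by (simp add: sum_shift_1[OF npos] G0)
  qed
  ultimately have "(real n - 1) * \<gamma>\<^sup>2 = real d * (real n - real d)"
    using npos by (simp add: of_nat_diff algebra_simps)
  also have "\<dots> = (real n - 1) * real u ^ 2"
  proof -
    have "real d * (real n - real d) = 4 * real u ^ 4 - (e * e) * real u ^ 2"
      unfolding d realn by (simp add: algebra_simps power2_eq_square power4_eq_xxxx)
    also have "\<dots> = (real n - 1) * real u ^ 2"
      unfolding ee realn by (simp add: algebra_simps power2_eq_square power4_eq_xxxx)
    finally show ?thesis .
  qed
  finally have "(real n - 1) * \<gamma>\<^sup>2 = (real n - 1) * real u ^ 2" .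
  \<comment> \<open>Divisibility by 4 excludes \<open>n = 1\<close>, so the factor
    \<open>n - 1\<close> can be cancelled.\<close>
  moreover have "4 dvd n" using n by simp
  then have "n \<noteq> 1" by auto
  then have "real n - 1 \<noteq> 0" by simp
  ultimately have "\<gamma>\<^sup>2 = real u ^ 2" by simp
  with \<gamma> have \<gamma>u: "\<gamma> = real u" by (simp add: power2_eq_iff_nonneg)
  \<comment> \<open>Column 0 is exempt from switching: its product with itself is \<open>d\<close>,
    and it has to become constant 1.\<close>
  define s :: "nat \<Rightarrow> real" where "s j = (if j \<noteq> 0 \<and> 0 < G j then -1 else 1)" for j
  have s: "s j \<in> {1, -1}" for j by (simp add: s_def)
  \<comment> \<open>\<open>F i 0\<close> switches row \<open>i\<close> to make column 0 constant;
    \<open>s j\<close> switches column \<open>j\<close> to make its product with column 0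
    negative.\<close>
  define f where "f i j = F i 0 * s j * F i j" for i j
  have f_pm: "f i j \<in> {1, -1}" if "i < d" "j < n" for i j
    unfolding f_def using that pm s npos by (intro pm1_mult) auto
  have f0: "f i 0 = 1" if "i < d" for i
    using sq[OF that npos] by (simp add: f_def s_def)
  have f_rows: "(\<Sum>j<n. f i j * f i' j) = (if i = i' then real n else 0)" if "i < d" "i' < d" for i i'
  proof -
    have "(\<Sum>j<n. f i j * f i' j) = (\<Sum>j<n. F i 0 * F i' 0 * (s j * s j) * (F i j * F i' j))"
      by (simp add: f_def mult_ac)
    also have "\<dots> = F i 0 * F i' 0 * (\<Sum>j<n. F i j * F i' j)"
      by (simp add: pm1_square[OF s] flip: sum_distrib_left)
    finally show ?thesis using that sq npos by (simp add: rows)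
  qed
  have f_cols: "\<bar>\<Sum>i<d. f i j * f i j'\<bar> = real u" if "j < n" "j' < n" "j \<noteq> j'" for j j'
  proof -
    have "(\<Sum>i<d. f i j * f i j') = (\<Sum>i<d. (F i 0 * F i 0) * (s j * s j') * (F i j * F i j'))"
      by (simp add: f_def mult_ac)
    also have "\<dots> = (s j * s j') * (\<Sum>i<d. F i j * F i j')"
      using sq npos by (simp flip: sum_distrib_left)
    finally show ?thesis using cols[OF that] s[of j] s[of j'] by (auto simp: abs_mult \<gamma>u)
  qed
  have f_sum: "(\<Sum>i<d. f i j) = - real u" if "0 < j" "j < n" for j
  proof -
    have "(\<Sum>i<d. f i j) = s j * G j"
      by (simp add: f_def G_def sum_distrib_left mult_ac)
    then show ?thesis
      using cols[of 0 j] that npos unfolding G_def[symmetric] \<gamma>u by (auto simp: s_def)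
  qed
  have f_row_sum: "(\<Sum>j<n - 1. f i (Suc j)) = e - 2 * real u" if "i < d" for i
  proof -
    \<comment> \<open>Column sums are inner products with the constant column 0. Weighted by row
      \<open>i\<close> they add up to \<open>n\<close> by row orthogonality; column 0 contributes
      \<open>d\<close>, every other column a multiple of \<open>- u\<close>.\<close>
    have "(\<Sum>j<n. (\<Sum>i'<d. f i' j) * f i j) = (\<Sum>i'<d. \<Sum>j<n. f i' j * f i j)"
      by (subst sum.swap) (simp add: sum_distrib_right)
    also have "\<dots> = real n"
      using that by (simp add: f_rows)
    finally have "real d - real u * (\<Sum>j<n - 1. f i (Suc j)) = real n"
      using that by (simp add: sum_shift_1[OF npos] f0 f_sum sum_negf flip: sum_distrib_left)
    then have "real u * (\<Sum>j<n - 1. f i (Suc j)) = real u * (e - 2 * real u)"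
      unfolding d realn by (simp add: algebra_simps power2_eq_square)
    then show ?thesis using u by simp
  qed
  show thesis
    by (rule that[OF f_pm f0 f_rows f_cols f_sum f_row_sum])
qed

text \<open>For two columns of a normalized frame this gives block intersections, for two rows the
  number of blocks through two points. The factor 4 is the source of the parity condition on
  \<open>u\<close>.\<close>

lemma card_common_ones:
  assumes "\<And>i. i < d \<Longrightarrow> a i \<in> {1, -1 :: real}" "\<And>i. i < d \<Longrightarrow> b i \<in> {1, -1 :: real}"
  shows "4 * real (card {i. i < d \<and> a i = 1 \<and> b i = 1}) =
    real d + (\<Sum>i<d. a i) + (\<Sum>i<d. b i) + (\<Sum>i<d. a i * b i)"
proof -
  have "(\<Sum>i<d. a i * b i) = (\<Sum>i<d. pm_sign (a i = 1) * pm_sign (b i = 1))"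
    and "(\<Sum>i<d. a i) = (\<Sum>i<d. pm_sign (a i = 1))"
    and "(\<Sum>i<d. b i) = (\<Sum>i<d. pm_sign (b i = 1))"
    using assms by (auto simp: pm_sign_eq_1 intro!: sum.cong)
  then show ?thesis
    by (simp add: sum_pm_sign_mult sum_pm_sign lessThan_def)
qed

lemma card_ones:
  assumes "\<And>i. i < d \<Longrightarrow> a i \<in> {1, -1 :: real}"
  shows "2 * real (card {i. i < d \<and> a i = 1}) = real d + (\<Sum>i<d. a i)"
proof -
  have "(\<Sum>i<d. a i) = (\<Sum>i<d. pm_sign (a i = 1))"
    using assms by (auto simp: pm_sign_eq_1 intro!: sum.cong)
  then show ?thesis
    by (simp add: sum_pm_sign lessThan_def)
qed

text \<open>The sign \<open>e\<close> selects one of the two families. For odd \<open>u\<close>, an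
  inner product \<open>e * u\<close> of two columns would make the number of their common ones
  fractional, so all of them are \<open>- e * u\<close>; tightness then forces
  \<open>u\<^sup>2 = 1\<close>.\<close>

lemma flat_etf_imp_even:
  fixes u d n :: nat and e :: real
  assumes etf: "flat_etf d n \<Phi>" and u: "2 \<le> u" and n: "n = 4 * u\<^sup>2"
    and d: "real d = 2 * real u ^ 2 + e * real u" and e: "e \<in> {1, -1}"
  shows "even u"
proof (rule ccontr)
  assume odd: "odd u"
  have upos: "0 < u" using u by simp
  obtain f where
    pm: "\<And>i j. i < d \<Longrightarrow> j < n \<Longrightarrow> f i j \<in> {1, -1 :: real}" and
    f0: "\<And>i. i < d \<Longrightarrow> f i 0 = 1" and
    rows: "\<And>i i'. i < d \<Longrightarrow> i' < d \<Longrightarrow>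
      (\<Sum>j<n. f i j * f i' j) = (if i = i' then real n else 0)" and
    cols: "\<And>j j'. j < n \<Longrightarrow> j' < n \<Longrightarrow> j \<noteq> j' \<Longrightarrow> \<bar>\<Sum>i<d. f i j * f i j'\<bar> = real u" and
    sums: "\<And>j. 0 < j \<Longrightarrow> j < n \<Longrightarrow> (\<Sum>i<d. f i j) = - real u" and
    row_sums: "\<And>i. i < d \<Longrightarrow> (\<Sum>j<n - 1. f i (Suc j)) = e - 2 * real u"
    by (rule flat_etf_normalized[OF etf upos n d e]) (rule that)
  have ip: "(\<Sum>i<d. f i j * f i j') = - e * real u"
    if j: "0 < j" "j < n" "0 < j'" "j' < n" "j \<noteq> j'" for j j'
  proof (rule ccontr)
    assume "(\<Sum>i<d. f i j * f i j') \<noteq> - e * real u"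
    with cols[OF j(2,4,5)] e have "(\<Sum>i<d. f i j * f i j') = e * real u" by auto
    then have card: "4 * real (card {i. i < d \<and> f i j = 1 \<and> f i j' = 1}) =
        2 * real u ^ 2 + 2 * e * real u - 2 * real u"
      using card_common_ones[of d "\<lambda>i. f i j" "\<lambda>i. f i j'"] pm j by (simp add: sums d)
    define P where "P = card {i. i < d \<and> f i j = 1 \<and> f i j' = 1}"
    from card e have "real (2 * P + 2 * u) = real (u\<^sup>2) \<or> real (2 * P) = real (u\<^sup>2)"
      unfolding P_def by auto
    then have "2 * P + 2 * u = u\<^sup>2 \<or> 2 * P = u\<^sup>2" unfolding of_nat_eq_iff .
    then have "even (u\<^sup>2)" by (metis dvd_add dvd_triv_left)
    with odd show False by simp
  qed
  have "2\<^sup>2 \<le> u\<^sup>2" using u by (rule power_mono) simp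
  then have n4: "1 < n" using n by simp
  \<comment> \<open>The inner products of column 1 with all columns except column 0 are summed
    twice: through the row sums, and as \<open>d\<close> for column 1 itself plus
    \<open>n - 2\<close> equal terms.\<close>
  have "(\<Sum>j<n - 1. \<Sum>i<d. f i 1 * f i (Suc j)) = (\<Sum>i<d. f i 1 * (\<Sum>j<n - 1. f i (Suc j)))"
    by (subst sum.swap) (simp add: sum_distrib_left)
  also have "\<dots> = (\<Sum>i<d. f i 1) * (e - 2 * real u)"
    unfolding sum_distrib_right by (intro sum.cong refl) (simp add: row_sums del: One_nat_def)
  also have "\<dots> = (e - 2 * real u) * (- real u)"
    using n4 by (simp add: sums)
  finally have *: "(\<Sum>j<n - 1. \<Sum>i<d. f i 1 * f i (Suc j)) = (e - 2 * real u) * (- real u)" .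
  have "(\<Sum>i<d. f i 1 * f i 1) = (\<Sum>i<d. 1)"
    by (intro sum.cong refl pm1_square pm) (use n4 in auto)
  then have "(\<Sum>j<n - 1. \<Sum>i<d. f i 1 * f i (Suc j)) = real d + (\<Sum>j<n - 1 - 1. - e * real u)"
    using n4 ip[of 1] by (simp add: sum_shift_1)
  with * have "real d - (real n - 2) * (e * real u) = (2 * real u - e) * real u"
    using n4 by (simp add: of_nat_diff algebra_simps)
  then have "e * real u * (4 * real u ^ 2) = e * real u * 4"
    unfolding d n by (simp add: algebra_simps power2_eq_square)
  then have "real u ^ 2 = 1" using e upos by auto
  then show False using u by (simp add: power2_eq_1_iff)
qed

text \<open>Block \<open>j\<close> is the set of ones in column \<open>Suc j\<close> of the
  normalized frame, column 0 being constant. The parameters enter as real equations cleared of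
  denominators, so that one proof serves both signs and avoids truncated subtraction.\<close>

lemma flat_etf_imp_qsd:
  fixes u d n k l r x y :: nat and e :: real
  assumes etf: "flat_etf d n \<Phi>" and u: "2 \<le> u" and n: "n = 4 * u\<^sup>2"
    and d: "real d = 2 * real u ^ 2 + e * real u" and e: "e \<in> {1, -1}"
    and k: "2 * real k = real d - real u"
    and r: "2 * real r = real n - 1 - 2 * real u + e"
    and l: "4 * real l = real n - 2 - 4 * real u + 2 * e"
    and x: "4 * real x = real d - 3 * real u" and y: "4 * real y = real d - real u"
  shows "qsd_exists d k l r (n - 1) x y"
proof -
  have upos: "0 < u" using u by simp
  have uu: "2 * real u \<le> real u ^ 2"
    using u by (simp add: power2_eq_square)
  have npos: "0 < n" using n upos by simp
  obtain f where
    pm: "\<And>i j. i < d \<Longrightarrow> j < n \<Longrightarrow> f i j \<in> {1, -1 :: real}" and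
    f0: "\<And>i. i < d \<Longrightarrow> f i 0 = 1" and
    rows: "\<And>i i'. i < d \<Longrightarrow> i' < d \<Longrightarrow>
      (\<Sum>j<n. f i j * f i' j) = (if i = i' then real n else 0)" and
    cols: "\<And>j j'. j < n \<Longrightarrow> j' < n \<Longrightarrow> j \<noteq> j' \<Longrightarrow> \<bar>\<Sum>i<d. f i j * f i j'\<bar> = real u" and
    sums: "\<And>j. 0 < j \<Longrightarrow> j < n \<Longrightarrow> (\<Sum>i<d. f i j) = - real u" and
    row_sums: "\<And>i. i < d \<Longrightarrow> (\<Sum>j<n - 1. f i (Suc j)) = e - 2 * real u"
    by (rule flat_etf_normalized[OF etf upos n d e]) (rule that)
  define B where "B j = {i. i < d \<and> f i (Suc j) = 1}" for j
  have "2 * real (card (B j)) = 2 * real k" if "j < n - 1" for j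
    unfolding B_def using that pm card_ones[of d "\<lambda>i. f i (Suc j)"] by (simp add: sums k)
  then have card_B: "card (B j) = k" if "j < n - 1" for j using that by simp
  have "2 * real (card {j. j < n - 1 \<and> i \<in> B j}) = 2 * real r" if "i < d" for i
    unfolding B_def using that pm card_ones[of "n - 1" "\<lambda>j. f i (Suc j)"] npos
    by (simp add: row_sums r of_nat_diff del: One_nat_def)
  then have card_r: "card {j. j < n - 1 \<and> i \<in> B j} = r" if "i < d" for i using that by simp
  have "4 * real (card {j. j < n - 1 \<and> i \<in> B j \<and> i' \<in> B j}) = 4 * real l"
    if i: "i < d" "i' < d" "i \<noteq> i'" for i i'
  proof -
    \<comment> \<open>The full rows are orthogonal and column 0 accounts for 1.\<close>
    have "(\<Sum>j<n - 1. f i (Suc j) * f i' (Suc j)) = - 1"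
      using rows[OF i(1,2)] i by (simp add: sum_shift_1[OF npos] f0)
    then show ?thesis
      unfolding B_def using i pm npos
        card_common_ones[of "n - 1" "\<lambda>j. f i (Suc j)" "\<lambda>j. f i' (Suc j)"]
      by (simp add: row_sums l of_nat_diff del: One_nat_def)
  qed
  then have card_l: "card {j. j < n - 1 \<and> i \<in> B j \<and> i' \<in> B j} = l"
    if "i < d" "i' < d" "i \<noteq> i'" for i i' using that by simp
  have inter: "card (B j \<inter> B j') \<in> {x, y}" if j: "j < n - 1" "j' < n - 1" "j \<noteq> j'" for j j'
  proof -
    have "B j \<inter> B j' = {i. i < d \<and> f i (Suc j) = 1 \<and> f i (Suc j') = 1}"
      by (auto simp: B_def)
    then have "4 * real (card (B j \<inter> B j')) =
        real d - 2 * real u + (\<Sum>i<d. f i (Suc j) * f i (Suc j'))"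
      using j pm card_common_ones[of d "\<lambda>i. f i (Suc j)" "\<lambda>i. f i (Suc j')"] by (simp add: sums)
    \<comment> \<open>The value \<open>u\<close> corresponds to intersection number
      \<open>y\<close>, the value \<open>- u\<close> to \<open>x\<close>.\<close>
    moreover have "(\<Sum>i<d. f i (Suc j) * f i (Suc j')) \<in> {real u, - real u}"
      using cols[of "Suc j" "Suc j'"] j by (simp add: less_diff_conv abs_if split: if_splits)
    ultimately have "4 * real (card (B j \<inter> B j')) \<in> {4 * real x, 4 * real y}"
      using x y by auto
    then show ?thesis by auto
  qed
  have realn: "real n = 4 * real u ^ 2" using n by simp
  have "0 < real k" "real k < real d" "real d < real (n - 1)" "real x < real y"
    using k d e uu upos x y npos realn by (auto simp: of_nat_diff)
  then have "quasi_symmetric_design {..<d} B d k l r (n - 1) x y"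
    unfolding quasi_symmetric_design_def bibd_def
    using card_B card_r card_l inter by (auto simp: B_def)
  then show ?thesis unfolding qsd_exists_def by blast
qed

text \<open>A constant column is put in front of the +-1 incidence vectors of the blocks. Then
  \<open>r\<close> and \<open>l\<close> make the rows orthogonal, \<open>k\<close> gives column sums
  \<open>- u\<close>, and \<open>x\<close>, \<open>y\<close> give inner products \<open>- u\<close>
  and \<open>u\<close>.\<close>

lemma qsd_imp_flat_etf:
  fixes u d n k l r x y :: nat and e :: real
  assumes qsd: "qsd_exists d k l r (n - 1) x y" and u: "2 \<le> u" and n: "n = 4 * u\<^sup>2"
    and k: "2 * real k = real d - real u"
    and r: "2 * real r = real n - 1 - 2 * real u + e"
    and l: "4 * real l = real n - 2 - 4 * real u + 2 * e"
    and x: "4 * real x = real d - 3 * real u" and y: "4 * real y = real d - real u"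
  shows "\<exists>\<Phi>. flat_etf d n \<Phi>"
proof -
  from qsd obtain V :: "nat set" and B where "quasi_symmetric_design V B d k l r (n - 1) x y"
    unfolding qsd_exists_def by blast
  then have V: "finite V" "card V = d" and dk: "k < d"
    and B: "\<And>j. j < n - 1 \<Longrightarrow> B j \<subseteq> V" "\<And>j. j < n - 1 \<Longrightarrow> card (B j) = k"
    and R: "\<And>p. p \<in> V \<Longrightarrow> card {j. j < n - 1 \<and> p \<in> B j} = r"
    and L: "\<And>p q. p \<in> V \<Longrightarrow> q \<in> V \<Longrightarrow> p \<noteq> q \<Longrightarrow> card {j. j < n - 1 \<and> p \<in> B j \<and> q \<in> B j} = l"
    and I: "\<And>i j. i < n - 1 \<Longrightarrow> j < n - 1 \<Longrightarrow> i \<noteq> j \<Longrightarrow> card (B i \<inter> B j) \<in> {x, y}"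
    unfolding quasi_symmetric_design_def bibd_def by blast+
  have npos: "0 < n" using n u by simp
  define F where "F p j = (if j = 0 then 1 else pm_sign (p \<in> B (j - 1)))" for p j
  have pm: "F p j \<in> {1, -1}" for p j by (simp add: F_def pm_sign_def)
  have B_eq: "{p \<in> V. p \<in> B j} = B j" if "j < n - 1" for j using B(1)[OF that] by auto
  have F_sum: "(\<Sum>p\<in>V. F p j) = - real u" if "0 < j" "j < n" for j
    using that B_eq[of "j - 1"] B(2)[of "j - 1"] V k by (simp add: F_def sum_pm_sign)
  have rows: "(\<Sum>j<n. F p j * F q j) = (if p = q then real n else 0)" if pq: "p \<in> V" "q \<in> V" for p q
  proof (cases "p = q")
    case True
    then show ?thesis using pm1_square[OF pm] by simp
  next
    case False
    have "(\<Sum>j<n. F p j * F q j) = 1 + (\<Sum>j<n - 1. pm_sign (p \<in> B j) * pm_sign (q \<in> B j))"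
      by (simp add: sum_shift_1[OF npos] F_def)
    then show ?thesis
      using R[OF pq(1)] R[OF pq(2)] L[OF pq False] False npos r l
      by (simp add: sum_pm_sign_mult of_nat_diff lessThan_def)
  qed
  have cols: "\<bar>\<Sum>p\<in>V. F p i * F p j\<bar> = real u" if ij: "i \<in> {..<n}" "j \<in> {..<n}" "i \<noteq> j" for i j
  proof (cases "i = 0 \<or> j = 0")
    case True
    then show ?thesis using ij F_sum[of i] F_sum[of j] by (auto simp: F_def)
  next
    case False
    have less: "i - 1 < n - 1" "j - 1 < n - 1" "i - 1 \<noteq> j - 1" using False ij by auto
    have "{p \<in> V. p \<in> B (i - 1) \<and> p \<in> B (j - 1)} = B (i - 1) \<inter> B (j - 1)"
      using B(1)[OF less(1)] by auto
    then have "(\<Sum>p\<in>V. F p i * F p j) = 4 * real (card (B (i - 1) \<inter> B (j - 1))) - 4 * real k + real d"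
      using False less V B(2) B_eq by (simp add: F_def sum_pm_sign_mult)
    then show ?thesis using I[OF less] x y k by auto
  qed
  obtain f where f: "bij_betw f {..<d} V"
    using ex_bij_betw_nat_finite[OF V(1)] V(2) by (auto simp: lessThan_atLeast0)
  have "bij_betw id {..<n} {..<n}" by simp
  from flat_etfI[OF f this pm rows cols _ npos] dk show ?thesis by auto
qed

text \<open>This is the sign \<open>e = - 1\<close>. The intersection numbers are fixed by real
  equations because \<open>u * (u - 2) / 2\<close> is an integer only for even
  \<open>u\<close>.\<close>

lemma flat_etf_iff_qsd_minus:
  fixes u :: nat
  assumes u: "2 \<le> u"
  shows "(\<exists>\<Phi>. flat_etf (u * (2 * u - 1)) (4 * u\<^sup>2) \<Phi>) \<longleftrightarrow>
    (\<exists>x y. real x = real u * (real u - 2) / 2 \<and> real y = real u * (real u - 1) / 2 \<and>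
      qsd_exists (2 * u\<^sup>2 - u) (u\<^sup>2 - u) (u\<^sup>2 - u - 1) (2 * u\<^sup>2 - u - 1) (4 * u\<^sup>2 - 1) x y)"
    (is "?etf \<longleftrightarrow> ?qsd")
    and "\<exists>\<Phi>. flat_etf (u * (2 * u - 1)) (4 * u\<^sup>2) \<Phi> \<Longrightarrow> even u"
proof -
  have le: "2 * u \<le> u\<^sup>2" using u by (simp add: power2_eq_square)
  have d_eq: "u * (2 * u - 1) = 2 * u\<^sup>2 - u"
    by (simp add: power2_eq_square algebra_simps diff_mult_distrib2)
  have d: "real (2 * u\<^sup>2 - u) = 2 * real u ^ 2 + (- 1) * real u"
    and k: "2 * real (u\<^sup>2 - u) = real (2 * u\<^sup>2 - u) - real u"
    and r: "2 * real (2 * u\<^sup>2 - u - 1) = real (4 * u\<^sup>2) - 1 - 2 * real u + (- 1)"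
    and l: "4 * real (u\<^sup>2 - u - 1) = real (4 * u\<^sup>2) - 2 - 4 * real u + 2 * (- 1)"
    using le u by (simp_all add: of_nat_diff)
  have x: "4 * real x = real (2 * u\<^sup>2 - u) - 3 * real u \<longleftrightarrow> real x = real u * (real u - 2) / 2"
    and y: "4 * real y = real (2 * u\<^sup>2 - u) - real u \<longleftrightarrow> real y = real u * (real u - 1) / 2" for x y
    unfolding d by (auto simp: algebra_simps power2_eq_square)
  show even: "even u" if "?etf"
    using that flat_etf_imp_even[OF _ u refl d] unfolding d_eq by auto
  show "?etf \<longleftrightarrow> ?qsd"
  proof
    assume etf: ?etf
    then obtain \<Phi> where \<Phi>: "flat_etf (2 * u\<^sup>2 - u) (4 * u\<^sup>2) \<Phi>" unfolding d_eq ..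
    \<comment> \<open>Both divisions are exact, since the existence of the frame has already made
      \<open>u\<close> even.\<close>
    define x' y' where "x' = u * (u - 2) div 2" and "y' = u * (u - 1) div 2"
    have "2 dvd u * (u - 2)" "2 dvd u * (u - 1)" using even[OF etf] by auto
    then have x': "real x' = real u * (real u - 2) / 2" and y': "real y' = real u * (real u - 1) / 2"
      using u by (simp_all add: x'_def y'_def real_of_nat_div of_nat_diff)
    from flat_etf_imp_qsd[OF \<Phi> u refl d _ k r l iffD2[OF x x'] iffD2[OF y y']] x' y'
    show ?qsd by auto
  next
    assume ?qsd
    then show ?etf
      unfolding d_eq
      by (elim exE conjE) (rule qsd_imp_flat_etf[OF _ u refl k r l iffD2[OF x] iffD2[OF y]])
  qed
qed

text \<open>This is the sign \<open>e = 1\<close>; here \<open>u\<^sup>2 / 2\<close> is the quotient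
  that is integral only for even \<open>u\<close>.\<close>

lemma flat_etf_iff_qsd_plus:
  fixes u :: nat
  assumes u: "2 \<le> u"
  shows "(\<exists>\<Phi>. flat_etf (u * (2 * u + 1)) (4 * u\<^sup>2) \<Phi>) \<longleftrightarrow>
    (\<exists>x y. real x = real u * (real u - 1) / 2 \<and> real y = real u ^ 2 / 2 \<and>
      qsd_exists (2 * u\<^sup>2 + u) (u\<^sup>2) (u\<^sup>2 - u) (2 * u\<^sup>2 - u) (4 * u\<^sup>2 - 1) x y)"
    (is "?etf \<longleftrightarrow> ?qsd")
    and "\<exists>\<Phi>. flat_etf (u * (2 * u + 1)) (4 * u\<^sup>2) \<Phi> \<Longrightarrow> even u"
proof -
  have le: "2 * u \<le> u\<^sup>2" using u by (simp add: power2_eq_square)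
  have d_eq: "u * (2 * u + 1) = 2 * u\<^sup>2 + u"
    by (simp add: power2_eq_square algebra_simps)
  have d: "real (2 * u\<^sup>2 + u) = 2 * real u ^ 2 + 1 * real u"
    and k: "2 * real (u\<^sup>2) = real (2 * u\<^sup>2 + u) - real u"
    and r: "2 * real (2 * u\<^sup>2 - u) = real (4 * u\<^sup>2) - 1 - 2 * real u + 1"
    and l: "4 * real (u\<^sup>2 - u) = real (4 * u\<^sup>2) - 2 - 4 * real u + 2 * 1"
    using le u by (simp_all add: of_nat_diff)
  have x: "4 * real x = real (2 * u\<^sup>2 + u) - 3 * real u \<longleftrightarrow> real x = real u * (real u - 1) / 2"
    and y: "4 * real y = real (2 * u\<^sup>2 + u) - real u \<longleftrightarrow> real y = real u ^ 2 / 2" for x y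
    unfolding d by (auto simp: algebra_simps power2_eq_square)
  show even: "even u" if "?etf"
    using that flat_etf_imp_even[OF _ u refl d] unfolding d_eq by auto
  show "?etf \<longleftrightarrow> ?qsd"
  proof
    assume etf: ?etf
    then obtain \<Phi> where \<Phi>: "flat_etf (2 * u\<^sup>2 + u) (4 * u\<^sup>2) \<Phi>" unfolding d_eq ..
    define x' y' where "x' = u * (u - 1) div 2" and "y' = u\<^sup>2 div 2"
    have "2 dvd u * (u - 1)" "2 dvd u\<^sup>2" using even[OF etf] by auto
    then have x': "real x' = real u * (real u - 1) / 2" and y': "real y' = real u ^ 2 / 2"
      using u by (simp_all add: x'_def y'_def real_of_nat_div of_nat_diff)
    from flat_etf_imp_qsd[OF \<Phi> u refl d _ k r l iffD2[OF x x'] iffD2[OF y y']] x' y'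
    show ?qsd by auto
  next
    assume ?qsd
    then show ?etf
      unfolding d_eq
      by (elim exE conjE) (rule qsd_imp_flat_etf[OF _ u refl k r l iffD2[OF x] iffD2[OF y]])
  qed
qed

subsection \<open>Hadamard matrices and the round-robin tournament\<close>

lemma bij_betw_self_finite:
  assumes "finite A" "f ` A \<subseteq> A" "inj_on f A"
  shows "bij_betw f A A"
  using assms by (simp add: bij_betw_def endo_inj_surj)

text \<open>The constant row 0 makes all other rows sum to 0, which the constructions below
  exploit.\<close>

definition normalized_hadamard :: "nat \<Rightarrow> (nat \<Rightarrow> nat \<Rightarrow> real) \<Rightarrow> bool" where
  "normalized_hadamard m h \<longleftrightarrow>
    (\<forall>i<m. \<forall>j<m. h i j \<in> {1, -1}) \<and> (\<forall>j<m. h 0 j = 1) \<and>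
    (\<forall>i<m. \<forall>i'<m. (\<Sum>j<m. h i j * h i' j) = (if i = i' then real m else 0))"

lemma
  assumes "normalized_hadamard m h"
  shows normalized_hadamard_pm: "i < m \<Longrightarrow> j < m \<Longrightarrow> h i j \<in> {1, -1}"
    and normalized_hadamard_row_0: "j < m \<Longrightarrow> h 0 j = 1"
    and normalized_hadamard_rows:
      "i < m \<Longrightarrow> i' < m \<Longrightarrow> (\<Sum>j<m. h i j * h i' j) = (if i = i' then real m else 0)"
  using assms unfolding normalized_hadamard_def by blast+

lemma normalized_hadamard_cols:
  assumes "normalized_hadamard m h" "j < m" "j' < m"
  shows "(\<Sum>i<m. h i j * h i j') = (if j = j' then real m else 0)"
  by (rule dual_orthogonality[where J = "{..<m}"]) (use assms normalized_hadamard_rows[OF assms(1)] in auto)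

lemma normalized_hadamard_row_sum:
  assumes "normalized_hadamard m h" "i < m"
  shows "(\<Sum>j<m. h i j) = (if i = 0 then real m else 0)"
proof -
  have "(\<Sum>j<m. h i j) = (\<Sum>j<m. h 0 j * h i j)"
    using normalized_hadamard_row_0[OF assms(1)] by simp
  also have "\<dots> = (if 0 = i then real m else 0)"
    using assms by (intro normalized_hadamard_rows) auto
  finally show ?thesis by auto
qed

text \<open>Multiplying each column by its entry in row 0 preserves row orthogonality and makes row
  0 constant.\<close>

lemma hadamard_matrix_normalized:
  assumes "hadamard_matrix m H"
  obtains h where "normalized_hadamard m h"
proof -
  have H: "H \<in> carrier_mat m m" "pm1_mat H" "H * transpose_mat H = real m \<cdot>\<^sub>m 1\<^sub>m m"
    using assms by (auto simp: hadamard_matrix_def)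
  have pm: "H $$ (i, j) \<in> {1, -1}" if "i < m" "j < m" for i j
    using that H by (auto simp: pm1_mat_def)
  have rows: "(\<Sum>j<m. H $$ (i, j) * H $$ (i', j)) = (if i = i' then real m else 0)"
    if "i < m" "i' < m" for i i'
    using arg_cong[OF H(3), of "\<lambda>A. A $$ (i, i')"] that H(1)
    by (simp add: scalar_prod_def lessThan_atLeast0)
  define h where "h i j = H $$ (0, j) * H $$ (i, j)" for i j
  have sq: "H $$ (0, j) * H $$ (0, j) = 1" if "j < m" for j
    using that by (intro pm1_square pm) auto
  have "(\<Sum>j<m. h i j * h i' j) = (\<Sum>j<m. H $$ (i, j) * H $$ (i', j))" for i i'
  proof (rule sum.cong)
    fix j assume "j \<in> {..<m}"
    then have "(H $$ (0, j) * H $$ (0, j)) * (H $$ (i, j) * H $$ (i', j)) = H $$ (i, j) * H $$ (i', j)"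
      using sq by simp
    then show "h i j * h i' j = H $$ (i, j) * H $$ (i', j)" by (simp add: h_def mult_ac)
  qed simp
  then have "normalized_hadamard m h"
    unfolding normalized_hadamard_def
  proof (intro conjI allI impI)
    show "h i j \<in> {1, -1}" if "i < m" "j < m" for i j
      unfolding h_def by (intro pm1_mult pm) (use that in auto)
  qed (simp_all add: rows sq h_def[of 0])
  then show thesis by (rule that)
qed

lemma sum_lessThan_double:
  fixes u :: nat
  shows "(\<Sum>j<2 * u. g j) = (\<Sum>l<u. g (2 * l) + g (2 * l + 1) :: real)"
  by (induction u) auto

text \<open>Sylvester doubling: the Kronecker product with the 2 by 2 Hadamard matrix, where
  \<open>div 2\<close> addresses \<open>h\<close> and the parity addresses the small factor.\<close>

lemma normalized_hadamard_double:
  assumes h: "normalized_hadamard u h"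
  shows "\<exists>K. normalized_hadamard (2 * u) K"
proof -
  define K where "K i j = h (i div 2) (j div 2) * (if odd i \<and> odd j then -1 else 1)" for i j
  have "K i j \<in> {1, -1}" if "i < 2 * u" "j < 2 * u" for i j
    unfolding K_def by (intro pm1_mult normalized_hadamard_pm[OF h]) (use that in auto)
  moreover have "K 0 j = 1" if "j < 2 * u" for j
    using that normalized_hadamard_row_0[OF h, of "j div 2"] by (simp add: K_def)
  moreover have "(\<Sum>j<2 * u. K i j * K i' j) = (if i = i' then real (2 * u) else 0)"
    if i: "i < 2 * u" "i' < 2 * u" for i i'
  proof -
    have "(\<Sum>j<2 * u. K i j * K i' j) =
        (\<Sum>l<u. h (i div 2) l * h (i' div 2) l) * (if odd i = odd i' then 2 else 0)"
      unfolding sum_lessThan_double sum_distrib_right by (intro sum.cong refl) (simp add: K_def)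
    also have "\<dots> = (if i div 2 = i' div 2 \<and> odd i = odd i' then 2 * real u else 0)"
      using i normalized_hadamard_rows[OF h, of "i div 2" "i' div 2"] by auto
    also have "i div 2 = i' div 2 \<and> odd i = odd i' \<longleftrightarrow> i = i'"
      by (metis div_mult_mod_eq parity_cases)
    finally show ?thesis by simp
  qed
  ultimately show ?thesis unfolding normalized_hadamard_def by blast
qed

section \<open>Meetings in a round-robin tournament\<close>

text \<open>
  The round-robin tournament on \<open>2 u\<close> players: in round \<open>c < 2 u - 1\<close>, player \<open>p\<close> sits at
  position \<open>round_pos u c p\<close>, the last player staying at the last position, and the players at
  positions \<open>t\<close> and \<open>2 u - 1 - t\<close> meet.
\<close>

definition round_pos :: "nat \<Rightarrow> nat \<Rightarrow> nat \<Rightarrow> nat" where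
  "round_pos u c p = (if p = 2 * u - 1 then p else (p + (2 * u - 1) - c) mod (2 * u - 1))"

text \<open>Two opposite positions share the smaller one as their label.\<close>

definition pair_label :: "nat \<Rightarrow> nat \<Rightarrow> nat" where
  "pair_label u t = (if t < u then t else 2 * u - 1 - t)"

lemma pair_label_less: "t < 2 * u \<Longrightarrow> pair_label u t < u"
  by (auto simp: pair_label_def)

lemma pair_label_eq_iff:
  "t < 2 * u \<Longrightarrow> t' < 2 * u \<Longrightarrow> t \<noteq> t' \<Longrightarrow> pair_label u t = pair_label u t' \<longleftrightarrow> t + t' = 2 * u - 1"
  by (auto simp: pair_label_def)

text \<open>Each pair has one position in either half, so a sum over positions splits pair by pair;
  the Boolean records the half.\<close>

lemma sum_pair_label:
  "(\<Sum>t<2 * u. g (t < u) (pair_label u t)) = (\<Sum>l<u. g True l + g False l :: real)"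
proof -
  have "{..<2 * u} = {..<u} \<union> {u..<2 * u}" by auto
  then have "(\<Sum>t<2 * u. g (t < u) (pair_label u t)) =
      (\<Sum>t\<in>{..<u} \<union> {u..<2 * u}. g (t < u) (pair_label u t))" by simp
  also have "\<dots> = (\<Sum>t<u. g (t < u) (pair_label u t)) + (\<Sum>t=u..<2 * u. g (t < u) (pair_label u t))"
    by (rule sum.union_disjoint) auto
  also have "(\<Sum>t<u. g (t < u) (pair_label u t)) = (\<Sum>l<u. g True l)"
    by (intro sum.cong) (auto simp: pair_label_def)
  also have "(\<Sum>t=u..<2 * u. g (t < u) (pair_label u t)) = (\<Sum>l<u. g False l)"
    by (rule sum.reindex_bij_witness[of _ "\<lambda>l. 2 * u - 1 - l" "\<lambda>t. 2 * u - 1 - t"])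
      (auto simp: pair_label_def)
  finally show ?thesis by (simp add: sum.distrib)
qed

lemma round_pos_less:
  assumes "p < 2 * u" "c < 2 * u - 1"
  shows "round_pos u c p < 2 * u"
proof -
  have "(p + (2 * u - 1) - c) mod (2 * u - 1) < 2 * u - 1"
    by (rule mod_less_divisor) (use assms in linarith)
  then have "(p + (2 * u - 1) - c) mod (2 * u - 1) < 2 * u" by linarith
  then show ?thesis using assms by (simp only: round_pos_def split: if_split) simp
qed

text \<open>Over the integers a position is a plain difference modulo \<open>2 * u - 1\<close>; the
  extra summand in \<open>round_pos\<close> only prevents truncation.\<close>

lemma int_round_pos:
  assumes "p < 2 * u" "p \<noteq> 2 * u - 1" "c < 2 * u - 1"
  shows "int (round_pos u c p) = (int p - int c) mod int (2 * u - 1)"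
proof -
  have "int (p + (2 * u - 1) - c) = (int p - int c) + int (2 * u - 1)"
    using assms by linarith
  then show ?thesis
    using assms by (simp only: round_pos_def if_False zmod_int mod_add_self2)
qed

text \<open>A round rotates all players cyclically except the last one, who is fixed.\<close>

lemma bij_betw_round_pos:
  assumes c: "c < 2 * u - 1"
  shows "bij_betw (round_pos u c) {..<2 * u} {..<2 * u}"
proof -
  have lt: "round_pos u c p < 2 * u - 1" if "p < 2 * u" "p \<noteq> 2 * u - 1" for p
    using that c unfolding round_pos_def by simp
  have "inj_on (round_pos u c) {..<2 * u}"
  proof (rule inj_onI)
    fix p q assume pq: "p \<in> {..<2 * u}" "q \<in> {..<2 * u}" and eq: "round_pos u c p = round_pos u c q"
    show "p = q"
    proof (cases "p = 2 * u - 1 \<or> q = 2 * u - 1")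
      case True
      moreover have "round_pos u c (2 * u - 1) = 2 * u - 1" by (simp add: round_pos_def)
      ultimately show ?thesis using lt[of p] lt[of q] pq eq by (metis lessThan_iff less_irrefl)
    next
      case False
      then have "(int p - int c) mod int (2 * u - 1) = (int q - int c) mod int (2 * u - 1)"
        using eq int_round_pos[of p u c] int_round_pos[of q u c] pq c by simp
      then have "(int p - int c + int c) mod int (2 * u - 1) = (int q - int c + int c) mod int (2 * u - 1)"
        by (metis mod_add_left_eq)
      then have "int p mod int (2 * u - 1) = int q mod int (2 * u - 1)" by simp
      then have "p mod (2 * u - 1) = q mod (2 * u - 1)" by (simp only: of_nat_eq_iff flip: zmod_int)
      moreover have "p < 2 * u - 1" "q < 2 * u - 1" using False pq by auto
      ultimately show ?thesis by simp
    qed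
  qed
  then show ?thesis
    using round_pos_less[OF _ c] by (intro bij_betw_self_finite) auto
qed

lemma ex1_common_round:
  assumes p: "p < 2 * u" and q: "q < 2 * u" and "p \<noteq> q"
  shows "\<exists>c0<2 * u - 1. \<forall>c<2 * u - 1.
    pair_label u (round_pos u c p) = pair_label u (round_pos u c q) \<longleftrightarrow> c = c0"
proof -
  define N where "N = 2 * u - 1"
  have meet: "pair_label u (round_pos u c p) = pair_label u (round_pos u c q) \<longleftrightarrow>
      round_pos u c p + round_pos u c q = N" if "c < N" for c
    unfolding N_def
  proof (rule pair_label_eq_iff)
    show "round_pos u c p \<noteq> round_pos u c q"
      using bij_betw_round_pos[of c u] that assms by (auto simp: N_def bij_betw_def inj_on_def)
  qed (use that p q N_def in \<open>auto intro: round_pos_less\<close>)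
  \<comment> \<open>Meeting the last player means standing at position 0, where player
    \<open>p\<close> stands in round \<open>p\<close> only.\<close>
  have last: "round_pos u c p + N = N \<longleftrightarrow> c = p" if "c < N" "p < N" for c p
  proof -
    have "int (round_pos u c p) = (int p - int c) mod int N"
      using that unfolding N_def by (intro int_round_pos) auto
    moreover have "(int p - int c) mod int N = 0 \<longleftrightarrow> c = p"
      using that by (metis diff_eq_eq diff_zero mod_0 mod_eq_dvd_iff mod_pos_pos_trivial of_nat_0_le_iff
        of_nat_eq_iff of_nat_less_iff dvd_eq_mod_eq_0)
    ultimately have "int (round_pos u c p) = 0 \<longleftrightarrow> c = p" by (simp only:)
    then show ?thesis by simp
  qed
  have roundN: "round_pos u c N = N" for c by (simp add: round_pos_def N_def)
  show ?thesis
  proof (cases "p = N \<or> q = N")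
    case True
    then obtain p' where p': "p' < N" "\<And>c. round_pos u c p + round_pos u c q = round_pos u c p' + N"
    proof (elim disjE)
      assume "p = N"
      then show thesis using that[of q] assms roundN by (auto simp: N_def add.commute)
    next
      assume "q = N"
      then show thesis using that[of p] assms roundN by (auto simp: N_def)
    qed
    then show ?thesis
      using meet last[OF _ p'(1)] unfolding N_def[symmetric] by (intro exI[of _ p']) auto
  next
    case False
    then have less: "p < N" "q < N" using p q by (auto simp: N_def)
    have u: "int N = 2 * int u - 1" using less by (simp add: N_def of_nat_diff)
    \<comment> \<open>Positions summing to 0 modulo \<open>N\<close> means
      \<open>2 * c = p + q\<close> modulo \<open>N\<close>. As \<open>2 * u = N + 1\<close>,
      multiplication by \<open>u\<close> inverts doubling.\<close>
    define c0 where "c0 = ((p + q) * u) mod N"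
    have c0: "c0 < N" using less by (simp add: c0_def)
    have "round_pos u c p + round_pos u c q = N \<longleftrightarrow> c = c0" if c: "c < N" for c
    proof -
      have rp: "int (round_pos u c t) = (int t - int c) mod int N" if "t < N" for t
      proof (rule int_round_pos[of t u c, folded N_def])
        show "t < 2 * u" using that by (simp add: N_def)
      qed (use that c in auto)
      have inj: "round_pos u c p \<noteq> round_pos u c q"
        using bij_betw_round_pos[of c u] c assms by (auto simp: N_def bij_betw_def inj_on_def)
      have lt: "round_pos u c p < N" "round_pos u c q < N"
        using less by (auto simp: round_pos_def N_def)
      \<comment> \<open>Two distinct positions below \<open>N\<close> have a sum strictly between 0
        and \<open>2 * N\<close>, so \<open>N\<close> is the only possible multiple.\<close>
      have "round_pos u c p + round_pos u c q = N \<longleftrightarrow> N dvd round_pos u c p + round_pos u c q"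
      proof
        assume "N dvd round_pos u c p + round_pos u c q"
        then obtain t where t: "round_pos u c p + round_pos u c q = N * t" by (auto elim: dvdE)
        have "N * t < N * 2" using lt unfolding t[symmetric] by simp
        then have "t < 2" by simp
        moreover have "t \<noteq> 0" using t inj by (intro notI) simp
        ultimately have "t = 1" by simp
        with t show "round_pos u c p + round_pos u c q = N" by simp
      qed simp
      also have "\<dots> \<longleftrightarrow> int N dvd int (round_pos u c p) + int (round_pos u c q)"
        by (simp flip: of_nat_add)
      also have "\<dots> \<longleftrightarrow> int N dvd (int p - int c) + (int q - int c)"
        unfolding rp[OF less(1)] rp[OF less(2)] by (simp add: dvd_eq_mod_eq_0 mod_simps)
      also have "\<dots> \<longleftrightarrow> int N dvd (int p + int q) * int u - int c"
      proof -
        have "2 * ((int p + int q) * int u - int c) =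
            ((int p - int c) + (int q - int c)) + int N * (int p + int q)"
          unfolding u by (simp add: algebra_simps)
        then have "int N dvd 2 * ((int p + int q) * int u - int c) \<longleftrightarrow>
            int N dvd (int p - int c) + (int q - int c)"
          by (metis dvd_add_left_iff dvd_triv_left)
        moreover have "coprime (int N) 2" using u by simp
        ultimately show ?thesis by (metis coprime_dvd_mult_right_iff)
      qed
      also have "\<dots> \<longleftrightarrow> int ((p + q) * u) mod int N = int c mod int N"
        by (simp add: mod_eq_dvd_iff)
      also have "\<dots> \<longleftrightarrow> c = c0"
      proof -
        have "int ((p + q) * u) mod int N = int c0" "int c mod int N = int c"
          using c by (simp_all only: c0_def mod_less flip: zmod_int)
        then show ?thesis by auto
      qed
      finally show ?thesis .
    qed
    then show ?thesis
      using meet c0 unfolding N_def[symmetric] by (intro exI[of _ c0]) auto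
  qed
qed

lemma hadamard_imp_naimark_pair:
  assumes "hadamard_matrix u H" and u: "0 < u"
  shows "\<exists>\<Phi> \<Psi>. flat_etf (u * (2 * u - 1)) (4 * u\<^sup>2) \<Phi> \<and> flat_etf (u * (2 * u + 1)) (4 * u\<^sup>2) \<Psi> \<and>
    naimark_complement (u * (2 * u - 1)) (4 * u\<^sup>2) \<Phi> \<Psi> \<and>
    naimark_complement (u * (2 * u + 1)) (4 * u\<^sup>2) \<Psi> \<Phi>"
proof -
  obtain h where h: "normalized_hadamard u h"
    using hadamard_matrix_normalized[OF assms(1)] .
  obtain K where K: "normalized_hadamard (2 * u) K"
    using normalized_hadamard_double[OF h] ..
  define N where "N = 2 * u - 1"
  have N: "2 * u = Suc N" using u by (simp add: N_def)
  define e where "e c p = pair_label u (round_pos u c p)" for c p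
  \<comment> \<open>\<open>Inl\<close> rows depend on the player only. In round \<open>c\<close>,
    the rows with \<open>b\<close> true are symmetric on each pair; those with \<open>b\<close>
    false change sign between the two halves.\<close>
  define A :: "nat + bool \<times> nat \<times> nat \<Rightarrow> nat \<Rightarrow> real" where
    "A r p = (case r of Inl i \<Rightarrow> K i p
      | Inr (b, c, i) \<Rightarrow> pm_sign (b \<or> round_pos u c p < u) * h i (e c p))" for r p
  \<comment> \<open>\<open>k\<close> selects the row of \<open>K\<close> used in the second
    coordinate: row 0, which is constant, for \<open>Inl\<close>, and a row of its own for each
    round.\<close>
  define k :: "nat + bool \<times> nat \<times> nat \<Rightarrow> nat" where
    "k r = (case r of Inl i \<Rightarrow> 0 | Inr (b, c, i) \<Rightarrow> Suc c)" for r
  define F where "F r = (\<lambda>(p, j). A r p * K (k r) j)" for r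
  define I where "I = (\<lambda>(c, i). Inr (True, c, i) :: nat + bool \<times> nat \<times> nat) ` ({..<N} \<times> {..<u})"
  define I' where "I' = Inl ` {..<2 * u} \<union>
    (\<lambda>(c, i). Inr (False, c, i) :: nat + bool \<times> nat \<times> nat) ` ({..<N} \<times> {..<u})"
  define J where "J = {..<2 * u} \<times> {..<2 * u}"
  have e_less: "e c p < u" if "c < N" "p < 2 * u" for c p
    using that unfolding e_def N_def by (intro pair_label_less round_pos_less)
  have r_cases: "(\<exists>i<2 * u. r = Inl i) \<or> (\<exists>b. \<exists>c<N. \<exists>i<u. r = Inr (b, c, i))" if "r \<in> I \<union> I'" for r
    using that by (auto simp: I_def I'_def)
  have k_less: "k r < 2 * u" if "r \<in> I \<union> I'" for r
    using r_cases[OF that] u N by (auto simp: k_def)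
  have A_pm: "A r p \<in> {1, -1}" if r: "r \<in> I \<union> I'" and p: "p < 2 * u" for r p
    using r_cases[OF r]
  proof (elim disjE exE conjE)
    fix i assume "i < 2 * u" "r = Inl i"
    then show ?thesis using normalized_hadamard_pm[OF K _ p] by (simp add: A_def)
  next
    fix b c i assume "c < N" "i < u" "r = Inr (b, c, i)"
    then show ?thesis
      using pm1_mult[OF pm_sign_cases normalized_hadamard_pm[OF h _ e_less[OF _ p]]]
      by (simp add: A_def)
  qed
  have A_orth: "(\<Sum>p<2 * u. A r p * A r' p) = (if r = r' then real (2 * u) else 0)"
    if r: "r \<in> I \<union> I'" "r' \<in> I \<union> I'" and k: "k r = k r'" for r r'
    using r_cases[OF r(1)]
  proof (elim disjE exE conjE)
    fix i assume i: "i < 2 * u" "r = Inl i"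
    with r_cases[OF r(2)] k obtain i' where "i' < 2 * u" "r' = Inl i'"
      by (auto simp: k_def)
    with i show ?thesis
      using normalized_hadamard_rows[OF K, of i i'] by (simp add: A_def)
  next
    fix b c i assume i: "c < N" "i < u" "r = Inr (b, c, i)"
    then have "k r' = Suc c" using k by (simp add: k_def)
    with r_cases[OF r(2)] have "\<exists>b' i'. i' < u \<and> r' = Inr (b', c, i')"
      by (elim disjE exE conjE) (simp_all add: k_def)
    then obtain b' i' where i': "i' < u" "r' = Inr (b', c, i')" by blast
    define g where "g \<tau> l = pm_sign (b \<or> \<tau>) * h i l * (pm_sign (b' \<or> \<tau>) * h i' l)" for \<tau> l
    have "(\<Sum>p<2 * u. A r p * A r' p) =
        (\<Sum>p<2 * u. g (round_pos u c p < u) (pair_label u (round_pos u c p)))"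
      by (simp add: A_def i i' g_def e_def)
    also have "\<dots> = (\<Sum>t<2 * u. g (t < u) (pair_label u t))"
      using i by (intro sum.reindex_bij_betw bij_betw_round_pos) (simp add: N_def)
    also have "\<dots> = (\<Sum>l<u. g True l + g False l)"
      by (rule sum_pair_label)
    \<comment> \<open>For \<open>b\<close> different from \<open>b'\<close>, the symmetric and the
      antisymmetric factor cancel on every pair.\<close>
    also have "\<dots> = (if b = b' then 2 else 0) * (\<Sum>l<u. h i l * h i' l)"
      unfolding sum_distrib_left by (intro sum.cong refl) (auto simp: g_def pm_sign_def)
    also have "\<dots> = (if r = r' then real (2 * u) else 0)"
      using normalized_hadamard_rows[OF h i(2) i'(1)] i i' by simp
    finally show ?thesis .
  qed
  have rows: "(\<Sum>x\<in>J. F r x * F r' x) = (if r = r' then real (4 * u\<^sup>2) else 0)"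
    if r: "r \<in> I \<union> I'" "r' \<in> I \<union> I'" for r r'
  proof -
    \<comment> \<open>The sum over the grid factors: rows with different \<open>k\<close> are
      orthogonal through \<open>K\<close>, rows with equal \<open>k\<close> through
      \<open>A\<close>.\<close>
    have "(\<Sum>x\<in>J. F r x * F r' x) =
        (\<Sum>p<2 * u. A r p * A r' p) * (\<Sum>j<2 * u. K (k r) j * K (k r') j)"
      unfolding J_def F_def sum_product sum.cartesian_product
      by (intro sum.cong refl) (auto simp: mult_ac)
    then show ?thesis
      using A_orth[OF r] normalized_hadamard_rows[OF K k_less[OF r(1)] k_less[OF r(2)]]
      by (auto simp: power2_eq_square)
  qed
  have pm: "F r x \<in> {1, -1}" if "r \<in> I \<union> I'" "x \<in> J" for r x
  proof -
    obtain p j where "x = (p, j)" "p < 2 * u" "j < 2 * u" using \<open>x \<in> J\<close> by (auto simp: J_def)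
    then show ?thesis
      unfolding F_def using pm1_mult[OF A_pm normalized_hadamard_pm[OF K k_less]] that by simp
  qed
  have cols: "\<bar>\<Sum>r\<in>I. F r x * F r y\<bar> = real u" if xy: "x \<in> J" "y \<in> J" "x \<noteq> y" for x y
  proof -
    obtain p j q j' where x: "x = (p, j)" "p < 2 * u" "j < 2 * u"
      and y: "y = (q, j')" "q < 2 * u" "j' < 2 * u"
      using xy by (auto simp: J_def)
    define w where "w c = K (Suc c) j * K (Suc c) j'" for c
    have w_pm: "w c \<in> {1, -1}" if "c < N" for c
      unfolding w_def using that x y N by (intro pm1_mult normalized_hadamard_pm[OF K]) auto
    have "(\<Sum>r\<in>I. F r x * F r y) =
        (\<Sum>(c, i)\<in>{..<N} \<times> {..<u}. F (Inr (True, c, i)) x * F (Inr (True, c, i)) y)"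
      unfolding I_def by (subst sum.reindex) (auto simp: inj_on_def case_prod_unfold)
    also have "\<dots> = (\<Sum>c<N. w c * (\<Sum>i<u. h i (e c p) * h i (e c q)))"
      unfolding sum.cartesian_product[symmetric] sum_distrib_left
      by (intro sum.cong refl) (simp add: F_def x y A_def k_def w_def pm_sign_def mult_ac)
    \<comment> \<open>Column orthogonality of \<open>h\<close> leaves only the rounds in which
      \<open>p\<close> and \<open>q\<close> carry the same pair label.\<close>
    also have "\<dots> = (\<Sum>c<N. w c * (if e c p = e c q then real u else 0))"
      using e_less x y by (intro sum.cong refl) (simp add: normalized_hadamard_cols[OF h])
    finally have eq: "(\<Sum>r\<in>I. F r x * F r y) = (\<Sum>c<N. w c * (if e c p = e c q then real u else 0))" .
    show ?thesis
    proof (cases "p = q")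
      case True
      then have "j \<noteq> j'" using xy x y by auto
      \<comment> \<open>For \<open>p = q\<close> every round survives, and two columns of
        \<open>K\<close> without their entries 1 in row 0 have inner product -1.\<close>
      then have "(\<Sum>c<Suc N. K c j * K c j') = 0"
        using normalized_hadamard_cols[OF K, of j j'] x y unfolding N by simp
      then have "(\<Sum>c<N. w c) = - 1"
        unfolding sum.lessThan_Suc_shift w_def
        using normalized_hadamard_row_0[OF K] x y by simp
      then show ?thesis unfolding eq True by (simp flip: sum_distrib_right)
    next
      case False
      obtain c0 where "c0 < N" "\<And>c. c < N \<Longrightarrow> e c p = e c q \<longleftrightarrow> c = c0"
        using ex1_common_round[OF x(2) y(2) False] unfolding e_def N_def by blast
      then have "(\<Sum>c<N. w c * (if e c p = e c q then real u else 0)) =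
          (\<Sum>c<N. if c = c0 then w c * real u else 0)"
        by (intro sum.cong refl) simp
      also have "\<dots> = w c0 * real u" using \<open>c0 < N\<close> by simp
      finally show ?thesis unfolding eq using w_pm[OF \<open>c0 < N\<close>] by (auto simp: abs_mult)
    qed
  qed
  have "card I = u * N"
    unfolding I_def by (subst card_image) (auto simp: inj_on_def mult.commute)
  moreover have "card I' = 2 * u + u * N"
    unfolding I'_def
    by (subst card_Un_disjoint) (auto simp: card_image inj_on_def mult.commute)
  moreover have "2 * u + u * N = u * (2 * u + 1)" "u * N + u * (2 * u + 1) = 4 * u\<^sup>2"
    unfolding N_def using u by (cases u; simp add: algebra_simps power2_eq_square)+
  moreover have "I \<inter> I' = {}" by (auto simp: I_def I'_def)
  moreover have "finite I" "finite I'" "finite J" by (auto simp: I_def I'_def J_def)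
  moreover have "card J = 4 * u\<^sup>2" by (simp add: J_def power2_eq_square)
  moreover have "0 < u * N" "0 < u * (2 * u + 1)" using u by (auto simp: N_def)
  ultimately show ?thesis
    using flat_etf_naimark_pair[of I I' J "u * N" "u * (2 * u + 1)" "4 * u\<^sup>2" "real u" F] pm rows cols
    unfolding N_def by simp
qed

subsection \<open>Nets\<close>

text \<open>\<open>line c p\<close> names the line through \<open>p\<close> in parallel class
  \<open>c\<close> of a net: rows, columns, then symbols. Lines from two classes share at most one
  point, by orthogonality for two squares and by the Latin property against rows or columns.\<close>

lemma
  assumes "mols t m L"
  defines "line \<equiv> \<lambda>c (i, j). if c = 0 then i else if c = 1 then j else L (c - 2) i j"
  assumes "c < t + 2"
  shows mols_line_less: "p \<in> {..<m} \<times> {..<m} \<Longrightarrow> line c p < m"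
    and mols_lines_inj: "c' < t + 2 \<Longrightarrow> c \<noteq> c' \<Longrightarrow> inj_on (\<lambda>p. (line c p, line c' p)) ({..<m} \<times> {..<m})"
proof -
  have latin: "inj_on (\<lambda>j. L s i j) {..<m}" "inj_on (\<lambda>i. L s i j) {..<m}" "L s i j < m"
    if "s < t" "i < m" "j < m" for s i j
    using assms(1) that unfolding mols_def latin_square_def bij_betw_def by blast+
  show "line c p < m" if "p \<in> {..<m} \<times> {..<m}"
    using that latin(3) assms(3) by (auto simp: line_def)
  have *: "inj_on (\<lambda>p. (line c p, line c' p)) ({..<m} \<times> {..<m})" if c: "c' < t + 2" "c < c'" for c c'
  proof (cases "2 \<le> c")
    case True
    then have "orthogonal_latin_squares m (L (c - 2)) (L (c' - 2))"
      using assms(1) c unfolding mols_def by auto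
    moreover have "(\<lambda>p. (line c p, line c' p)) = (\<lambda>(i, j). (L (c - 2) i j, L (c' - 2) i j))"
      using True c by (auto simp: line_def fun_eq_iff)
    ultimately show ?thesis
      unfolding orthogonal_latin_squares_def bij_betw_def by simp
  next
    case False
    show ?thesis
    proof (rule inj_onI)
      fix p q assume "p \<in> {..<m} \<times> {..<m}" "q \<in> {..<m} \<times> {..<m}"
        and eq: "(line c p, line c' p) = (line c q, line c' q)"
      then obtain i j i' j' where p: "p = (i, j)" "i < m" "j < m" and q: "q = (i', j')" "i' < m" "j' < m"
        by auto
      consider "c = 0" "c' = 1" | "c = 0" "2 \<le> c'" | "c = 1" "2 \<le> c'" using c False by linarith
      then show "p = q"
      proof cases
        case 1
        then show ?thesis using eq p q by (simp add: line_def)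
      next
        case 2
        then have "i = i'" "L (c' - 2) i j = L (c' - 2) i' j'" using eq p q by (auto simp: line_def)
        moreover have "inj_on (\<lambda>j. L (c' - 2) i j) {..<m}" using latin(1)[of "c' - 2" i j] 2 c p by simp
        ultimately show ?thesis using p q by (auto dest: inj_onD)
      next
        case 3
        then have "j = j'" "L (c' - 2) i j = L (c' - 2) i' j'" using eq p q by (auto simp: line_def)
        moreover have "inj_on (\<lambda>i. L (c' - 2) i j) {..<m}" using latin(2)[of "c' - 2" i j] 3 c p by simp
        ultimately show ?thesis using p q by (auto dest: inj_onD)
      qed
    qed
  qed
  show "inj_on (\<lambda>p. (line c p, line c' p)) ({..<m} \<times> {..<m})" if "c' < t + 2" "c \<noteq> c'"
  proof (cases "c < c'")
    case True
    then show ?thesis using * that by blast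
  next
    case False
    then have "inj_on (\<lambda>p. (line c' p, line c p)) ({..<m} \<times> {..<m})"
      using * that assms(3) by simp
    then show ?thesis by (auto simp: inj_on_def)
  qed
qed

text \<open>For different classes the two line labels run independently over the grid, so the row
  sum factors and vanishes unless \<open>i = i' = 0\<close>. In a column product, a class
  contributes \<open>m - 1\<close> if the points share its line and -1 otherwise.\<close>

lemma
  fixes line :: "nat \<Rightarrow> nat \<times> nat \<Rightarrow> nat"
  defines "P m \<equiv> {..<m} \<times> {..<m}"
  assumes h: "normalized_hadamard m h" and T: "2 \<le> T"
    and range: "\<And>c p. c < T \<Longrightarrow> p \<in> P m \<Longrightarrow> line c p < m"
    and inj: "\<And>c c'. c < T \<Longrightarrow> c' < T \<Longrightarrow> c \<noteq> c' \<Longrightarrow> inj_on (\<lambda>p. (line c p, line c' p)) (P m)"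
  shows net_hadamard_rows: "\<lbrakk>c < T; c' < T; i < m; i' < m; i = 0 \<and> i' = 0 \<longrightarrow> c = c'\<rbrakk> \<Longrightarrow>
      (\<Sum>p\<in>P m. h i (line c p) * h i' (line c' p)) = (if c = c' \<and> i = i' then real m * real m else 0)"
    and net_hadamard_cols: "\<lbrakk>p \<in> P m; q \<in> P m; p \<noteq> q\<rbrakk> \<Longrightarrow>
      (\<Sum>c<T. \<Sum>i\<in>{1..<m}. h i (line c p) * h i (line c q)) \<in> {- real T, real m - real T}"
proof -
  have bij: "bij_betw (\<lambda>p. (line c p, line c' p)) (P m) (P m)" if "c < T" "c' < T" "c \<noteq> c'" for c c'
    using inj[OF that] range that by (intro bij_betw_self_finite) (auto simp: P_def)
  have sum2: "(\<Sum>p\<in>P m. f (line c p) * g (line c' p)) = (\<Sum>a<m. f a) * (\<Sum>b<m. g b)"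
    if "c < T" "c' < T" "c \<noteq> c'" for c c' and f g :: "nat \<Rightarrow> real"
  proof -
    have "(\<Sum>p\<in>P m. f (line c p) * g (line c' p)) = (\<Sum>(a, b)\<in>P m. f a * g b)"
      using sum.reindex_bij_betw[OF bij[OF that], of "\<lambda>(a, b). f a * g b"] by simp
    then show ?thesis by (simp add: P_def sum_product sum.cartesian_product)
  qed
  show "(\<Sum>p\<in>P m. h i (line c p) * h i' (line c' p)) = (if c = c' \<and> i = i' then real m * real m else 0)"
    if c: "c < T" "c' < T" and i: "i < m" "i' < m" and 0: "i = 0 \<and> i' = 0 \<longrightarrow> c = c'"
  proof (cases "c = c'")
    case True
    \<comment> \<open>A second class exists as \<open>2 \<le> T\<close>; pairing with the constant 1
      on it shows that every line of class \<open>c\<close> has \<open>m\<close> points.\<close>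
    obtain d where "d < T" "c \<noteq> d"
    proof
      show "(if c = 0 then 1 else 0) < T" "c \<noteq> (if c = 0 then 1 else 0)" using T by auto
    qed
    then have "(\<Sum>p\<in>P m. h i (line c p) * h i' (line c p)) = (\<Sum>a<m. h i a * h i' a) * real m"
      using sum2[OF c(1), of d "\<lambda>a. h i a * h i' a" "\<lambda>_. 1"] by simp
    then show ?thesis using normalized_hadamard_rows[OF h i] True by simp
  next
    case False
    then show ?thesis
      using sum2[OF c False, of "h i" "h i'"] 0 i by (auto simp: normalized_hadamard_row_sum[OF h])
  qed
  show "(\<Sum>c<T. \<Sum>i\<in>{1..<m}. h i (line c p) * h i (line c q)) \<in> {- real T, real m - real T}"
    if p: "p \<in> P m" and q: "q \<in> P m" and "p \<noteq> q"
  proof -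
    have m: "0 < m" using p by (auto simp: P_def)
    have inner: "(\<Sum>i\<in>{1..<m}. h i (line c p) * h i (line c q)) =
        (if line c p = line c q then real m else 0) - 1" if "c < T" for c
    proof -
      have "{..<m} = insert 0 {1..<m}" using m by auto
      then have "(\<Sum>i<m. h i (line c p) * h i (line c q)) =
          h 0 (line c p) * h 0 (line c q) + (\<Sum>i\<in>{1..<m}. h i (line c p) * h i (line c q))"
        by simp
      then show ?thesis
        using range[OF that p] range[OF that q]
        by (simp add: normalized_hadamard_cols[OF h] normalized_hadamard_row_0[OF h])
    qed
    \<comment> \<open>\<open>C\<close> collects the classes in which \<open>p\<close> and
      \<open>q\<close> lie on one line; two such classes would contradict injectivity.\<close>
    define C where "C = {c. c < T \<and> line c p = line c q}"
    have "(\<Sum>c<T. \<Sum>i\<in>{1..<m}. h i (line c p) * h i (line c q)) =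
        (\<Sum>c<T. (if line c p = line c q then real m else 0) - 1)"
      by (intro sum.cong refl inner) simp
    also have "\<dots> = (\<Sum>c<T. if line c p = line c q then real m else 0) - real T"
      by (simp add: sum_subtractf)
    also have "(\<Sum>c<T. if line c p = line c q then real m else 0) = real (card C) * real m"
      by (simp add: sum.If_cases C_def Int_def)
    finally have sum: "(\<Sum>c<T. \<Sum>i\<in>{1..<m}. h i (line c p) * h i (line c q)) =
        real (card C) * real m - real T" .
    have "c = c'" if "c \<in> C" "c' \<in> C" for c c'
    proof (rule ccontr)
      assume "c \<noteq> c'"
      from inj_onD[OF inj[OF _ _ this] _ p q] that \<open>p \<noteq> q\<close> show False by (simp add: C_def)
    qed
    then have "card C \<le> 1" by (simp add: card_le_Suc0_iff_eq C_def)
    then have "card C = 0 \<or> card C = 1" by linarith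
    then show ?thesis unfolding sum by auto
  qed
qed

text \<open>The inner products are \<open>- (t + 2)\<close> and \<open>2 * u - (t + 2)\<close>. With
  \<open>t + 2 = u\<close> they are \<open>- u\<close> and \<open>u\<close>; with
  \<open>t + 2 = u + 1\<close> adding one constant row raises both by 1 to the same values.\<close>

lemma mols_hadamard_imp_flat_etf:
  assumes H: "hadamard_matrix (2 * u) H" and L: "mols t (2 * u) L" and u: "2 \<le> u"
  shows "u = t + 2 \<Longrightarrow> \<exists>\<Phi>. flat_etf (u * (2 * u - 1)) (4 * u\<^sup>2) \<Phi>"
    and "u = t + 1 \<Longrightarrow> \<exists>\<Phi>. flat_etf (u * (2 * u + 1)) (4 * u\<^sup>2) \<Phi>"
proof -
  define m where "m = 2 * u"
  define line where
    "line c = (\<lambda>(i, j). if c = 0 then i else if c = 1 then j else L (c - 2) i j)" for c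
  define J where "J = {..<m} \<times> {..<m}"
  obtain h where h: "normalized_hadamard m h"
    using hadamard_matrix_normalized[OF H] unfolding m_def .
  have line_less: "line c p < m" if "c < t + 2" "p \<in> J" for c p
    using mols_line_less[OF L, of c p] that unfolding line_def J_def m_def by simp
  have line_inj: "inj_on (\<lambda>p. (line c p, line c' p)) J" if "c < t + 2" "c' < t + 2" "c \<noteq> c'" for c c'
    using mols_lines_inj[OF L, of c c'] that unfolding line_def J_def m_def by simp
  define F where "F = (\<lambda>(c, i) p. h i (line c p))"
  have rows: "(\<Sum>p\<in>J. F (c, i) p * F (c', i') p) = (if (c, i) = (c', i') then real (4 * u\<^sup>2) else 0)"
    if "c < t + 2" "c' < t + 2" "i < m" "i' < m" "i = 0 \<and> i' = 0 \<longrightarrow> c = c'" for c c' i i'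
    using net_hadamard_rows[OF h _ _ _ that, of line] line_less line_inj
    by (simp add: J_def F_def m_def power2_eq_square)
  have cols: "(\<Sum>(c, i)\<in>{..<t + 2} \<times> {1..<m}. F (c, i) p * F (c, i) q) \<in>
      {- real (t + 2), real m - real (t + 2)}" if "p \<in> J" "q \<in> J" "p \<noteq> q" for p q
    using net_hadamard_cols[OF h, of "t + 2" line p q] line_less line_inj that
    unfolding J_def F_def sum.cartesian_product[symmetric] by simp
  have pm: "F (c, i) p \<in> {1, -1}" if "c < t + 2" "i < m" "p \<in> J" for c i p
    unfolding F_def using normalized_hadamard_pm[OF h that(2) line_less[OF that(1,3)]] by simp
  have card_J: "card J = 4 * u\<^sup>2" "finite J" by (simp_all add: J_def m_def power2_eq_square)
  show "\<exists>\<Phi>. flat_etf (u * (2 * u - 1)) (4 * u\<^sup>2) \<Phi>" if t: "u = t + 2"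
  proof (rule flat_etf_exI)
    show "card ({..<u} \<times> {1..<m}) = u * (2 * u - 1)" by (simp add: m_def)
    show "\<bar>\<Sum>r\<in>{..<u} \<times> {1..<m}. F r p * F r q\<bar> = real u" if "p \<in> J" "q \<in> J" "p \<noteq> q" for p q
      using cols[OF that] unfolding t[symmetric] m_def by (auto simp: case_prod_unfold)
    show "(\<Sum>p\<in>J. F r p * F r' p) = (if r = r' then real (4 * u\<^sup>2) else 0)"
      if r: "r \<in> {..<u} \<times> {1..<m}" "r' \<in> {..<u} \<times> {1..<m}" for r r'
    proof -
      have "fst r < t + 2" "fst r' < t + 2" "snd r < m" "snd r' < m"
        "snd r = 0 \<and> snd r' = 0 \<longrightarrow> fst r = fst r'"
        using r t by (auto simp: mem_Times_iff)
      from rows[OF this] show ?thesis by (simp only: prod.collapse)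
    qed
    show "F r p \<in> {1, -1}" if "r \<in> {..<u} \<times> {1..<m}" "p \<in> J" for r p
      using pm[of "fst r" "snd r" p] that t by (auto simp: mem_Times_iff)
  qed (use u card_J in auto)
  show "\<exists>\<Phi>. flat_etf (u * (2 * u + 1)) (4 * u\<^sup>2) \<Phi>" if t: "u = t + 1"
  proof (rule flat_etf_exI)
    \<comment> \<open>Row 0 of the Hadamard matrix gives the same constant row in every class, so it
      is included once, as \<open>(0, 0)\<close>.\<close>
    define I where "I = insert (0, 0) ({..<t + 2} \<times> {1..<m})"
    have I: "fst r < t + 2" "snd r < m" if "r \<in> I" for r
      using that u by (auto simp: I_def m_def)
    have "u * (2 * u + 1) = Suc (Suc u * (2 * u - 1))" using u by (cases u) simp_all
    then show "card I = u * (2 * u + 1)" by (simp add: I_def m_def t)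
    have one: "F (0, 0) p = 1" if "p \<in> J" for p
      using normalized_hadamard_row_0[OF h line_less[OF _ that]] by (simp add: F_def)
    show "\<bar>\<Sum>r\<in>I. F r p * F r q\<bar> = real u" if pq: "p \<in> J" "q \<in> J" "p \<noteq> q" for p q
    proof -
      have "(\<Sum>r\<in>I. F r p * F r q) = 1 + (\<Sum>r\<in>{..<t + 2} \<times> {1..<m}. F r p * F r q)"
        using pq by (simp add: I_def one)
      then show ?thesis
        using cols[OF pq] t unfolding m_def by (auto simp: case_prod_unfold)
    qed
    show "(\<Sum>p\<in>J. F r p * F r' p) = (if r = r' then real (4 * u\<^sup>2) else 0)"
      if r: "r \<in> I" "r' \<in> I" for r r'
    proof -
      have "snd r = 0 \<and> snd r' = 0 \<longrightarrow> fst r = fst r'"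
        using r by (auto simp: I_def)
      from rows[OF I(1)[OF r(1)] I(1)[OF r(2)] I(2)[OF r(1)] I(2)[OF r(2)] this]
      show ?thesis by (simp only: prod.collapse)
    qed
    show "F r p \<in> {1, -1}" if "r \<in> I" "p \<in> J" for r p
      using pm[of "fst r" "snd r" p] that I[OF that(1)] by auto
    show "finite I" by (simp add: I_def)
  qed (use u card_J in auto)
qed

subsection \<open>Order 12\<close>

definition add12 :: "nat \<Rightarrow> nat \<Rightarrow> nat" where
  "add12 a b = 2 * ((a div 2 + b div 2) mod 6) + (a + b) mod 2"

definition sub12 :: "nat \<Rightarrow> nat \<Rightarrow> int \<times> nat" where
  "sub12 a b = ((int (a div 2) - int (b div 2)) mod 6, (a + b) mod 2)"

text \<open>
  \<open>add12\<close> and \<open>sub12\<close> are the operations of the group $\mathbb{Z}_6 \times \mathbb{Z}_2$, with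
  $(a, b)$ coded as $2a + b$ (the values of \<open>sub12\<close> are left uncoded). In the following matrix,
  found by computer search, every row and every difference of two rows is a permutation of the group.
\<close>

definition diff12 :: "nat list list" where
  "diff12 =
    [[0, 1, 2, 3, 4, 5, 6, 7, 8, 9, 10, 11],
     [0, 4, 9, 11, 1, 6, 8, 5, 7, 3, 2, 10],
     [0, 2, 8, 5, 3, 9, 1, 10, 4, 7, 11, 6],
     [0, 11, 6, 9, 5, 8, 2, 4, 3, 10, 7, 1],
     [0, 9, 5, 1, 6, 10, 7, 11, 2, 4, 3, 8]]"

lemma add12_less: "add12 a b < 12"
  unfolding add12_def by presburger

lemma add12_div_2: "add12 a b div 2 = (a div 2 + b div 2) mod 6"
  and even_add12: "even (add12 a b) \<longleftrightarrow> even (a + b)"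
  by (auto simp: add12_def mod2_eq_if)

lemma sub12_add12:
  assumes "b < 12"
  shows "sub12 (add12 a b) a = (int (b div 2), b mod 2)"
proof -
  have "(add12 a b + a) mod 2 = b mod 2"
    by (auto simp: mod2_eq_if even_add12)
  moreover have "b div 2 < 6" using assms by simp
  ultimately show ?thesis
    by (simp add: sub12_def add12_div_2 zmod_int mod_simps)
qed

lemma sub12_add12_add12: "sub12 (add12 c a) (add12 c b) = sub12 a b"
proof -
  have "(add12 c a + add12 c b) mod 2 = (a + b) mod 2"
    by (auto simp: mod2_eq_if even_add12)
  then show ?thesis
    by (simp add: sub12_def add12_div_2 zmod_int mod_simps)
qed

lemma add12_commute: "add12 a b = add12 b a"
  by (simp add: add12_def add.commute)

lemma diff12_less: "s < 5 \<Longrightarrow> j < 12 \<Longrightarrow> diff12 ! s ! j < 12"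
proof -
  assume "s < 5" "j < 12"
  moreover have "list_all (\<lambda>s. list_all (\<lambda>j. diff12 ! s ! j < 12) [0..<12]) [0..<5]"
    by code_simp
  ultimately show ?thesis by (simp add: list_all_iff)
qed

lemma inj_on_diff12: "s < 5 \<Longrightarrow> inj_on (\<lambda>j. diff12 ! s ! j) {..<12}"
proof -
  assume "s < 5"
  moreover have "list_all (\<lambda>s. distinct (map (\<lambda>j. diff12 ! s ! j) [0..<12])) [0..<5]"
    by code_simp
  ultimately show ?thesis by (simp add: list_all_iff distinct_map lessThan_atLeast0)
qed

lemma inj_on_sub12_diff12:
  assumes "s < 5" "t < 5" "s \<noteq> t"
  shows "inj_on (\<lambda>j. sub12 (diff12 ! s ! j) (diff12 ! t ! j)) {..<12}"
proof -
  have "list_all (\<lambda>s. list_all (\<lambda>t. s \<noteq> t \<longrightarrow>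
      distinct (map (\<lambda>j. sub12 (diff12 ! s ! j) (diff12 ! t ! j)) [0..<12])) [0..<5]) [0..<5]"
    by code_simp
  with assms show ?thesis by (simp add: list_all_iff distinct_map lessThan_atLeast0)
qed

text \<open>Each square is the group table with columns rearranged by a row of
  \<open>diff12\<close>. If two cells agree in two squares, subtracting the squares removes the row
  index; injectivity of the row difference gives \<open>j = j'\<close>, and cancellation gives
  \<open>i = i'\<close>.\<close>

lemma mols_12: "mols 5 12 (\<lambda>s i j. add12 i (diff12 ! s ! j))"
proof -
  have canc: "b = b'" if "add12 a b = add12 a b'" "b < 12" "b' < 12" for a b b'
    using that sub12_add12[of b a] sub12_add12[of b' a] div_mult_mod_eq[of b 2] div_mult_mod_eq[of b' 2]
    by simp
  have "latin_square 12 (\<lambda>i j. add12 i (diff12 ! s ! j))" if s: "s < 5" for s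
    unfolding latin_square_def
  proof (intro conjI allI impI)
    fix i :: nat assume i: "i < 12"
    show "bij_betw (\<lambda>j. add12 i (diff12 ! s ! j)) {..<12} {..<12}"
    proof (rule bij_betw_self_finite)
      show "inj_on (\<lambda>j. add12 i (diff12 ! s ! j)) {..<12}"
        using canc diff12_less[OF s] inj_on_diff12[OF s]
        unfolding inj_on_def by (metis lessThan_iff)
    qed (auto simp: add12_less)
  next
    fix j :: nat assume j: "j < 12"
    show "bij_betw (\<lambda>i. add12 i (diff12 ! s ! j)) {..<12} {..<12}"
    proof (rule bij_betw_self_finite)
      show "inj_on (\<lambda>i. add12 i (diff12 ! s ! j)) {..<12}"
        using canc
        unfolding inj_on_def by (metis lessThan_iff add12_commute)
    qed (auto simp: add12_less)
  qed
  moreover have "orthogonal_latin_squares 12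
      (\<lambda>i j. add12 i (diff12 ! s ! j)) (\<lambda>i j. add12 i (diff12 ! t ! j))"
    if s: "s < 5" "t < 5" "s \<noteq> t" for s t
    unfolding orthogonal_latin_squares_def
  proof (rule bij_betw_self_finite)
    show "inj_on (\<lambda>(i, j). (add12 i (diff12 ! s ! j), add12 i (diff12 ! t ! j)))
      ({..<12} \<times> {..<12})"
    proof (rule inj_onI, clarsimp)
      fix i j i' j' :: nat
      assume less: "i < 12" "j < 12" "i' < 12" "j' < 12"
        and eq: "add12 i (diff12 ! s ! j) = add12 i' (diff12 ! s ! j')"
          "add12 i (diff12 ! t ! j) = add12 i' (diff12 ! t ! j')"
      have "sub12 (diff12 ! s ! j) (diff12 ! t ! j) = sub12 (diff12 ! s ! j') (diff12 ! t ! j')"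
        using eq less diff12_less s sub12_add12_add12 by metis
      then have "j = j'"
        using inj_on_sub12_diff12[OF s] less unfolding inj_on_def by blast
      moreover from this eq(1) less canc diff12_less[OF s(1)] have "i = i'"
        by (metis add12_commute)
      ultimately show "i = i' \<and> j = j'" by simp
    qed
  qed (auto simp: add12_less)
  ultimately show ?thesis by (simp add: mols_def)
qed

text \<open>The Paley construction for the prime 11, bordered by ones; the list holds the nonzero
  squares modulo 11. Integer values let evaluation decide orthogonality.\<close>

definition paley12 :: "nat \<Rightarrow> nat \<Rightarrow> int" where
  "paley12 i j =
    (if i = 0 \<or> j = 0 then 1
     else if (j + 11 - i) mod 11 \<in> set [1, 3, 4, 5, 9] then 1 else -1)"

lemma hadamard_12: "hadamard_matrix 12 (mat 12 12 (\<lambda>(i, j). real_of_int (paley12 i j)))"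
proof -
  have "list_all (\<lambda>i. list_all (\<lambda>j.
      sum_list (map (\<lambda>l. paley12 i l * paley12 j l) [0..<12]) = (if i = j then 12 else 0))
      [0..<12]) [0..<12]"
    by code_simp
  then have "(\<Sum>l = 0..<12. paley12 i l * paley12 j l) = (if i = j then 12 else 0)"
    if "i < 12" "j < 12" for i j
    using that by (simp add: list_all_iff sum_list_distinct_conv_sum_set)
  then have "(\<Sum>l = 0..<12. real_of_int (paley12 i l) * real_of_int (paley12 j l))
      = (if i = j then 12 else 0)" if "i < 12" "j < 12" for i j
    using that by (simp flip: of_int_mult of_int_sum)
  then show ?thesis
    by (auto simp: hadamard_matrix_def pm1_mat_def scalar_prod_def paley12_def)
qed

lemma mols_mono: "mols t m L \<Longrightarrow> s \<le> t \<Longrightarrow> mols s m L"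
  by (auto simp: mols_def)

theorem corollary1:
  fixes u :: nat
  assumes "u \<ge> 2"
  shows
    "(((\<exists>\<Phi>. flat_etf (u * (2 * u - 1)) (4 * u ^ 2) \<Phi>) \<longleftrightarrow>
        (\<exists>x y. real x = real u * (real u - 2) / 2 \<and> real y = real u * (real u - 1) / 2 \<and>
           qsd_exists (2 * u ^ 2 - u) (u ^ 2 - u) (u ^ 2 - u - 1) (2 * u ^ 2 - u - 1) (4 * u ^ 2 - 1) x y)) \<and>
      ((\<exists>H. hadamard_matrix u H) \<longrightarrow> (\<exists>\<Phi>. flat_etf (u * (2 * u - 1)) (4 * u ^ 2) \<Phi>)) \<and>
      ((\<exists>H. hadamard_matrix (2 * u) H) \<and> (\<exists>L. mols (u - 2) (2 * u) L) \<longrightarrow>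
        (\<exists>\<Phi>. flat_etf (u * (2 * u - 1)) (4 * u ^ 2) \<Phi>)) \<and>
      (u = 6 \<longrightarrow> (\<exists>H. hadamard_matrix (2 * u) H) \<and> (\<exists>L. mols (u - 2) (2 * u) L)))
     \<and>
     (((\<exists>\<Phi>. flat_etf (u * (2 * u + 1)) (4 * u ^ 2) \<Phi>) \<longleftrightarrow>
        (\<exists>x y. real x = real u * (real u - 1) / 2 \<and> real y = real u ^ 2 / 2 \<and>
           qsd_exists (2 * u ^ 2 + u) (u ^ 2) (u ^ 2 - u) (2 * u ^ 2 - u) (4 * u ^ 2 - 1) x y)) \<and>
      ((\<exists>H. hadamard_matrix u H) \<longrightarrow> (\<exists>\<Phi>. flat_etf (u * (2 * u + 1)) (4 * u ^ 2) \<Phi>)) \<and>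
      ((\<exists>H. hadamard_matrix (2 * u) H) \<and> (\<exists>L. mols (u - 1) (2 * u) L) \<longrightarrow>
        (\<exists>\<Phi>. flat_etf (u * (2 * u + 1)) (4 * u ^ 2) \<Phi>)) \<and>
      (u = 6 \<longrightarrow> (\<exists>H. hadamard_matrix (2 * u) H) \<and> (\<exists>L. mols (u - 1) (2 * u) L)))
     \<and>
     (((\<exists>\<Phi>. flat_etf (u * (2 * u - 1)) (4 * u ^ 2) \<Phi>) \<or>
       (\<exists>\<Phi>. flat_etf (u * (2 * u + 1)) (4 * u ^ 2) \<Phi>) \<longrightarrow> even u) \<and>
      ((\<exists>H. hadamard_matrix u H) \<longrightarrow>
        (\<exists>\<Phi> \<Psi>. flat_etf (u * (2 * u - 1)) (4 * u ^ 2) \<Phi> \<and>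
               flat_etf (u * (2 * u + 1)) (4 * u ^ 2) \<Psi> \<and>
               naimark_complement (u * (2 * u - 1)) (4 * u ^ 2) \<Phi> \<Psi> \<and>
               naimark_complement (u * (2 * u + 1)) (4 * u ^ 2) \<Psi> \<Phi>)))"
proof -
  have mols_minus: "\<exists>\<Phi>. flat_etf (u * (2 * u - 1)) (4 * u\<^sup>2) \<Phi>"
    if "hadamard_matrix (2 * u) H" "mols (u - 2) (2 * u) L" for H L
    using mols_hadamard_imp_flat_etf(1)[OF that assms] assms by simp
  have mols_plus: "\<exists>\<Phi>. flat_etf (u * (2 * u + 1)) (4 * u\<^sup>2) \<Phi>"
    if "hadamard_matrix (2 * u) H" "mols (u - 1) (2 * u) L" for H L
    using mols_hadamard_imp_flat_etf(2)[OF that assms] assms by simp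
  \<comment> \<open>For \<open>u = 6\<close> the five squares of order 12 are the required
    \<open>u - 1\<close>, and four of them are the required \<open>u - 2\<close>.\<close>
  have six: "\<exists>H. hadamard_matrix (2 * u) H" "\<exists>L. mols (u - 2) (2 * u) L"
    "\<exists>L. mols (u - 1) (2 * u) L" if "u = 6"
    unfolding that using hadamard_12 mols_12 mols_mono[OF mols_12, of 4] by auto
  have pair: "\<exists>\<Phi> \<Psi>. flat_etf (u * (2 * u - 1)) (4 * u\<^sup>2) \<Phi> \<and>
      flat_etf (u * (2 * u + 1)) (4 * u\<^sup>2) \<Psi> \<and>
      naimark_complement (u * (2 * u - 1)) (4 * u\<^sup>2) \<Phi> \<Psi> \<and>
      naimark_complement (u * (2 * u + 1)) (4 * u\<^sup>2) \<Psi> \<Phi>"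
    if "hadamard_matrix u H" for H
    using hadamard_imp_naimark_pair[OF that] assms by simp
  show ?thesis
    using flat_etf_iff_qsd_minus[OF assms] flat_etf_iff_qsd_plus[OF assms]
      mols_minus mols_plus six pair
    by (intro conjI impI) blast+
qed

end
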